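(* Consider the closed-form approximate uplink achievable rate $R_{\mathrm{IP},n}$ of the $n$th user of a mixed-ADC massive MIMO system with MRC receiver and imperfect CSI over Rician fading channels, as given in the context. With $p_u=E_u/M^{\gamma}$ ($E_u$ fixed) and $M\to\infty$, the limit of $R_{\mathrm{IP},n}$ converges to $$R_{\mathrm{IP},n}\to\log_2\left(1+(\rho\kappa+\alpha)\,\frac{E_u\beta_n\left(M^{\gamma}K_n+\tau E_u\beta_n\right)}{M^{2\gamma-1}(K_n+1)}\right),\qquad\text{as } M\to\infty.$$ The power-scaling law with imperfect CSI depends on the value of the $n$th user's Rician factor $K_n$: for Rayleigh fading channels ($K_n=0$), the user transmit power $p_u$ can be at most cut down by a factor of $1/\sqrt{M}$; if there is a line-of-sight component ($K_n>0$), the transmit power of each user can be scaled down proportionally to $1/M$. For the special case of low-resolution ADC architectures ($\kappa=0$), the limit reduces to $$R_{\mathrm{IP},n}\to\log_2\left(1+\frac{\alpha E_u\beta_n\left(M^{\gamma}K_n+\tau E_u\beta_n\right)}{M^{2\gamma-1}(K_n+1)}\right),\qquad\text{as } M\to\infty.$$ For unquantized massive MIMO systems ($\kappa=1$, $\alpha=1$), it converges to a constant value as $$R_{\mathrm{IP},n}\to\log_2\left(1+\frac{E_u\beta_n\left(M^{\gamma}K_n+\tau E_u\beta_n\right)}{M^{2\gamma-1}(K_n+1)}\right),\qquad\text{as } M\to\infty,$$ which is the exact achievable rate of unquantized massive MIMO systems.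
   Context: Uplink of a single-cell massive MIMO system with $N$ single-antenna users and $M$ base-station antennas, $N\ll M$. Of the $M=M_0+M_1$ antennas, $M_0$ are connected to high-resolution ADCs and $M_1$ to low-resolution ADCs; $\kappa=M_0/M$, $0\le\kappa\le1$, is the proportion of high-resolution ADCs. $\rho$ is the distortion factor of the low-resolution ADCs and $\alpha=1-\rho$ is the corresponding linear gain in the additive quantization noise model. $p_u$ is the transmit power of each user; $\tau$ symbols of each coherence interval are used for pilots, and the pilot power is $p_p=\tau p_u$; the channel is estimated by MMSE. For user $i=1,\dots,N$: $\beta_i$ is the large-scale fading coefficient, $K_i$ the Rician $K$-factor (ratio of the power of the deterministic line-of-sight component to that of the scattered components), and $\theta_i$ the angle of arrival. The line-of-sight channel matrix has entries $\exp(-j(m-1)kd\sin\theta_n)$ (here $j$ is the imaginary unit, $m$ the antenna index and $n$ the user index), with $d$ the inter-antenna spacing, $k=2\pi d/\lambda$, and $\lambda$ the wavelength. Define, for $i\ne n$ and $j=0,1$, $$\phi_{ni,j}=\frac{\sin\left(M_jkd(\sin\theta_n-\sin\theta_i)/2\right)}{\sin\left(kd(\sin\theta_n-\sin\theta_i)/2\right)},$$ and, for every $i$, $$\eta_i=\frac{p_p\beta_i}{1+p_p\beta_i},\qquad \sigma_i^2=\frac{\beta_i}{(1+p_p\beta_i)(K_i+1)}.$$ Further put, for $i\neq n$, $$\Delta_3^{(i)}=\frac{\beta_i}{K_i+1}K_nK_i\left(\phi_{ni,0}^2+\alpha^2\phi_{ni,1}^2\right)+\frac{\beta_i(M_0+\alpha^2M_1)}{K_i+1}\left(K_i\eta_n+K_n\eta_i+\eta_n\eta_i\right),$$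 $$\Delta_4=\beta_n\left(K_n^2+4K_n\eta_n+2\eta_n^2\right)+(K_n+1)(K_n+\eta_n)\sum_{i\ne n}\frac{\beta_i(K_i+\eta_i)}{K_i+1}.$$ The closed-form approximate achievable rate of user $n$ is $R_{\mathrm{IP},n}=\log_2(1+A/B)$ with $$A=p_u\beta_n\left[(M_0+\alpha M_1)^2(K_n+\eta_n)^2+(M_0+\alpha^2M_1)(\eta_n^2+2K_n\eta_n)\right],$$ $$B=(M_0+\alpha M_1)(K_n+\eta_n)(K_n+1)\left(1+p_u\sum_{i=1}^N\sigma_i^2\right)+p_u(K_n+1)\sum_{i\ne n}\Delta_3^{(i)}+\alpha\rho p_uM_1\Delta_4.$$ *)

theory Defs
  imports "HOL-Probability.Probability"
begin

text \<open>
  The fixed parameters of the cell. Users are numbered 1, ..., \<open>users S\<close>; the values of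
  \<open>\<beta>\<close>, \<open>Kf\<close> (Rician factor) and \<open>\<theta>\<close> at other indices are irrelevant.
\<close>

record rician_uplink =
  users :: nat
  \<beta> :: "nat \<Rightarrow> real"
  Kf :: "nat \<Rightarrow> real"
  \<theta> :: "nat \<Rightarrow> real"
  spacing :: real
  wavelength :: real
  pilot_len :: nat

definition kd :: "rician_uplink \<Rightarrow> real" where
  "kd S = (2 * pi * spacing S / wavelength S) * spacing S"

text \<open>
  \<open>\<phi> S n i m\<close> is $\phi_{ni,j}$ with $m = M_j$. It is meaningful only if the denominator
  does not vanish (HOL division would silently return 0).
\<close>

definition \<phi> :: "rician_uplink \<Rightarrow> nat \<Rightarrow> nat \<Rightarrow> nat \<Rightarrow> real" where
  "\<phi> S n i m = sin (real m * kd S * (sin (\<theta> S n) - sin (\<theta> S i)) / 2)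
             / sin (kd S * (sin (\<theta> S n) - sin (\<theta> S i)) / 2)"

definition pilot_power :: "rician_uplink \<Rightarrow> real \<Rightarrow> real" where
  "pilot_power S pu = real (pilot_len S) * pu"

definition \<eta> :: "rician_uplink \<Rightarrow> real \<Rightarrow> nat \<Rightarrow> real" where
  "\<eta> S pu i = pilot_power S pu * \<beta> S i / (1 + pilot_power S pu * \<beta> S i)"

definition \<sigma>2 :: "rician_uplink \<Rightarrow> real \<Rightarrow> nat \<Rightarrow> real" where
  "\<sigma>2 S pu i = \<beta> S i / ((1 + pilot_power S pu * \<beta> S i) * (Kf S i + 1))"

definition \<Delta>3 ::
  "rician_uplink \<Rightarrow> real \<Rightarrow> nat \<Rightarrow> nat \<Rightarrow> real \<Rightarrow> nat \<Rightarrow> nat \<Rightarrow> real" where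
  "\<Delta>3 S \<alpha> M0 M1 pu n i =
     \<beta> S i / (Kf S i + 1) * Kf S n * Kf S i * ((\<phi> S n i M0)\<^sup>2 + \<alpha>\<^sup>2 * (\<phi> S n i M1)\<^sup>2)
   + \<beta> S i * (real M0 + \<alpha>\<^sup>2 * real M1) / (Kf S i + 1)
       * (Kf S i * \<eta> S pu n + Kf S n * \<eta> S pu i + \<eta> S pu n * \<eta> S pu i)"

definition \<Delta>4 :: "rician_uplink \<Rightarrow> real \<Rightarrow> nat \<Rightarrow> real" where
  "\<Delta>4 S pu n =
     \<beta> S n * ((Kf S n)\<^sup>2 + 4 * Kf S n * \<eta> S pu n + 2 * (\<eta> S pu n)\<^sup>2)
   + (Kf S n + 1) * (Kf S n + \<eta> S pu n)
       * (\<Sum>i\<in>{1..users S} - {n}. \<beta> S i * (Kf S i + \<eta> S pu i) / (Kf S i + 1))"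

definition rate_num ::
  "rician_uplink \<Rightarrow> real \<Rightarrow> nat \<Rightarrow> nat \<Rightarrow> real \<Rightarrow> nat \<Rightarrow> real" where
  "rate_num S \<alpha> M0 M1 pu n =
     pu * \<beta> S n * ((real M0 + \<alpha> * real M1)\<^sup>2 * (Kf S n + \<eta> S pu n)\<^sup>2
       + (real M0 + \<alpha>\<^sup>2 * real M1) * ((\<eta> S pu n)\<^sup>2 + 2 * Kf S n * \<eta> S pu n))"

definition rate_den ::
  "rician_uplink \<Rightarrow> real \<Rightarrow> real \<Rightarrow> nat \<Rightarrow> nat \<Rightarrow> real \<Rightarrow> nat \<Rightarrow> real" where
  "rate_den S \<rho> \<alpha> M0 M1 pu n =
     (real M0 + \<alpha> * real M1) * (Kf S n + \<eta> S pu n) * (Kf S n + 1)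
       * (1 + pu * (\<Sum>i=1..users S. \<sigma>2 S pu i))
   + pu * (Kf S n + 1) * (\<Sum>i\<in>{1..users S} - {n}. \<Delta>3 S \<alpha> M0 M1 pu n i)
   + \<alpha> * \<rho> * pu * real M1 * \<Delta>4 S pu n"

definition R_IP ::
  "rician_uplink \<Rightarrow> real \<Rightarrow> real \<Rightarrow> nat \<Rightarrow> nat \<Rightarrow> real \<Rightarrow> nat \<Rightarrow> real" where
  "R_IP S \<rho> \<alpha> M0 M1 pu n =
     log 2 (1 + rate_num S \<alpha> M0 M1 pu n / rate_den S \<rho> \<alpha> M0 M1 pu n)"

text \<open>
  The exact ergodic rate of the unquantized system with M antennas, MRC and MMSE channel
  estimates. The line-of-sight part is known, so the estimate of the channel of user i is the
  line-of-sight column plus an estimated scattered part whose entries are independent circularly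
  symmetric complex Gaussians of variance $\beta_i\eta_i/(K_i+1)$; the orthogonal estimation error
  has the remaining variance $\sigma_i^2 = \beta_i(1-\eta_i)/(K_i+1)$ per entry and is treated as
  noise. The noise variance is 1.
\<close>

definition complex_gaussian :: "complex measure" where
  "complex_gaussian =
     distr (density lborel (\<lambda>x. ennreal (normal_density 0 (1 / sqrt 2) x))
              \<Otimes>\<^sub>M density lborel (\<lambda>x. ennreal (normal_density 0 (1 / sqrt 2) x)))
           borel (\<lambda>(x, y). Complex x y)"

definition scatter_law :: "rician_uplink \<Rightarrow> nat \<Rightarrow> (nat \<times> nat \<Rightarrow> complex) measure" where
  "scatter_law S M = PiM ({1..M} \<times> {1..users S}) (\<lambda>_. complex_gaussian)"

definition los :: "rician_uplink \<Rightarrow> nat \<Rightarrow> nat \<Rightarrow> complex" where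
  "los S m i = exp (- \<i> * complex_of_real ((real m - 1) * kd S * sin (\<theta> S i)))"

definition g_hat ::
  "rician_uplink \<Rightarrow> real \<Rightarrow> (nat \<times> nat \<Rightarrow> complex) \<Rightarrow> nat \<Rightarrow> nat \<Rightarrow> complex" where
  "g_hat S pu w m i = complex_of_real (sqrt (\<beta> S i / (Kf S i + 1)))
     * (complex_of_real (sqrt (Kf S i)) * los S m i
        + complex_of_real (sqrt (\<eta> S pu i)) * w (m, i))"

definition g_inner ::
  "rician_uplink \<Rightarrow> nat \<Rightarrow> real \<Rightarrow> (nat \<times> nat \<Rightarrow> complex) \<Rightarrow> nat \<Rightarrow> nat \<Rightarrow> complex" where
  "g_inner S M pu w n i = (\<Sum>m=1..M. cnj (g_hat S pu w m n) * g_hat S pu w m i)"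

definition exact_sinr ::
  "rician_uplink \<Rightarrow> nat \<Rightarrow> real \<Rightarrow> nat \<Rightarrow> (nat \<times> nat \<Rightarrow> complex) \<Rightarrow> real" where
  "exact_sinr S M pu n w =
     pu * (cmod (g_inner S M pu w n n))\<^sup>2
     / (pu * (\<Sum>i\<in>{1..users S} - {n}. (cmod (g_inner S M pu w n i))\<^sup>2)
        + cmod (g_inner S M pu w n n) * (1 + pu * (\<Sum>i=1..users S. \<sigma>2 S pu i)))"

definition exact_unquantized_rate ::
  "rician_uplink \<Rightarrow> nat \<Rightarrow> real \<Rightarrow> nat \<Rightarrow> real" where
  "exact_unquantized_rate S M pu n =
     (\<integral>w. log 2 (1 + exact_sinr S M pu n w) \<partial>scatter_law S M)"

end

theory Submission
  imports Defs "HOL-Real_Asymp.Real_Asymp"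
begin

text \<open>
  Write \<open>p = p\<^sub>u\<close> and \<open>c = \<rho>\<kappa> + \<alpha>\<close>, so that \<open>M\<^sub>0 + \<alpha> M\<^sub>1 = c M\<close>. After dividing the SINR by the leading
  part of its denominator, every remaining interference and quantization term is at most a constant
  times \<open>p\<close>, uniformly in \<open>M\<close>; the line-of-sight interference is harmless because \<open>\<phi>\<close> stays
  bounded. Hence the rate is \<open>log 2 (1 + c M p \<beta>\<^sub>n (K\<^sub>n + \<eta>\<^sub>n) / (K\<^sub>n + 1))\<close> up to an error that
  vanishes with \<open>p\<close>, and \<open>\<eta>\<^sub>n\<close> may be replaced by \<open>\<tau> p \<beta>\<^sub>n\<close> at the cost of a factor at most
  \<open>1 + \<tau> p \<beta>\<^sub>n\<close>.

  For the exact ergodic rate let \<open>Y\<close> be the squared norm of the estimated channel of user \<open>n\<close> and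
  \<open>\<mu>\<close> its mean. Since the SINR is at most \<open>p Y\<close>, concavity of the logarithm bounds the rate by
  \<open>log 2 (1 + p \<mu>)\<close>. Conversely, \<open>Y / \<mu>\<close> has variance of order \<open>1 / M\<close> and the expected
  interference is of order \<open>p \<mu>\<close>, so outside an event of probability of order
  \<open>1 / (M \<epsilon>\<^sup>2) + p / \<epsilon>\<close> the SINR is at least \<open>p \<mu>\<close> times a factor close to 1. The logarithm
  grows only like \<open>log M\<close>, so \<open>\<epsilon> = M powr (- \<delta>)\<close> with small \<open>\<delta>\<close> makes the loss vanish.
\<close>

subsection \<open>Moments of the complex Gaussian law\<close>

text \<open>The common law of the real and imaginary parts: variance 1/2 for each gives the complex
  variable unit second moment.\<close>

definition half_gaussian :: "real measure" where
  "half_gaussian = density lborel (\<lambda>x. ennreal (normal_density 0 (1 / sqrt 2) x))"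

lemma sets_half_gaussian [measurable_cong, simp]: "sets half_gaussian = sets borel"
  by (simp add: half_gaussian_def)

lemma prob_space_half_gaussian: "prob_space half_gaussian"
  unfolding half_gaussian_def by (rule prob_space_normal_density) simp

lemma half_gaussian_moments:
  shows "integrable half_gaussian (\<lambda>x. x ^ k)"
    and "(\<integral>x. x \<partial>half_gaussian) = 0"
    and "(\<integral>x. x\<^sup>2 \<partial>half_gaussian) = 1 / 2"
proof -
  have pos: "0 < 1 / sqrt 2" by simp
  have *: "integrable half_gaussian f \<longleftrightarrow> integrable lborel (\<lambda>x. normal_density 0 (1 / sqrt 2) x * f x)"
    "integral\<^sup>L half_gaussian f = (\<integral>x. normal_density 0 (1 / sqrt 2) x * f x \<partial>lborel)"
    if [measurable]: "f \<in> borel_measurable borel" for f :: "real \<Rightarrow> real"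
    unfolding half_gaussian_def
    by (simp_all add: integrable_density integral_density)
  show "integrable half_gaussian (\<lambda>x. x ^ k)"
    using integrable_normal_moment[OF pos, of 0 k] by (simp add: *)
  show "(\<integral>x. x \<partial>half_gaussian) = 0"
    using integral_normal_moment_nz_1[OF pos, of 0] by (simp add: *)
  show "(\<integral>x. x\<^sup>2 \<partial>half_gaussian) = 1 / 2"
    using integral_normal_moment_even[OF pos, of 0 1] by (simp add: * power_divide)
qed

lemma complex_gaussian_altdef:
  "complex_gaussian = distr (half_gaussian \<Otimes>\<^sub>M half_gaussian) borel (\<lambda>(x, y). Complex x y)"
  by (simp add: complex_gaussian_def half_gaussian_def)

lemma measurable_Complex_pair [measurable]:
  "(\<lambda>(x, y). Complex x y) \<in> borel_measurable (half_gaussian \<Otimes>\<^sub>M half_gaussian)"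
  unfolding Complex_eq by measurable

lemma sets_complex_gaussian [measurable_cong, simp]: "sets complex_gaussian = sets borel"
  by (simp add: complex_gaussian_def)

lemma space_complex_gaussian [simp]: "space complex_gaussian = UNIV"
  by (simp add: complex_gaussian_def)

lemma prob_space_complex_gaussian: "prob_space complex_gaussian"
  unfolding complex_gaussian_altdef
  by (intro prob_space.prob_space_distr prob_space_pair prob_space_half_gaussian
        measurable_Complex_pair)

lemma distr_Re_complex_gaussian: "distr complex_gaussian half_gaussian Re = half_gaussian"
proof -
  interpret prob_space half_gaussian by (rule prob_space_half_gaussian)
  have "distr complex_gaussian half_gaussian Re
      = distr (half_gaussian \<Otimes>\<^sub>M half_gaussian) half_gaussian (Re \<circ> (\<lambda>(x, y). Complex x y))"
    unfolding complex_gaussian_altdef by (subst distr_distr) measurable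
  also have "Re \<circ> (\<lambda>(x, y). Complex x y) = fst" by auto
  finally show ?thesis by (simp add: distr_pair_fst)
qed

lemma distr_Im_complex_gaussian: "distr complex_gaussian half_gaussian Im = half_gaussian"
proof -
  interpret prob_space half_gaussian by (rule prob_space_half_gaussian)
  interpret pair_sigma_finite half_gaussian half_gaussian ..
  have "distr complex_gaussian half_gaussian Im
      = distr (half_gaussian \<Otimes>\<^sub>M half_gaussian) half_gaussian (Im \<circ> (\<lambda>(x, y). Complex x y))"
    unfolding complex_gaussian_altdef by (subst distr_distr) measurable
  \<comment> \<open>The product law is invariant under swapping the coordinates, so the second
    marginal reduces to the first.\<close>
  also have "Im \<circ> (\<lambda>(x, y). Complex x y) = fst \<circ> (\<lambda>(x, y). (y, x))" by auto
  also have "distr (half_gaussian \<Otimes>\<^sub>M half_gaussian) half_gaussian \<dots>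
      = distr (distr (half_gaussian \<Otimes>\<^sub>M half_gaussian) (half_gaussian \<Otimes>\<^sub>M half_gaussian)
          (\<lambda>(x, y). (y, x))) half_gaussian fst"
    by (subst distr_distr) measurable
  also have "\<dots> = half_gaussian"
    by (simp add: distr_pair_swap[symmetric] distr_pair_fst)
  finally show ?thesis .
qed

lemma complex_gaussian_Re_Im:
  assumes "g \<in> borel_measurable borel" "integrable half_gaussian g"
  shows "integrable complex_gaussian (\<lambda>z. g (Re z) :: real)"
    and "integrable complex_gaussian (\<lambda>z. g (Im z))"
    and "(\<integral>z. g (Re z) \<partial>complex_gaussian) = integral\<^sup>L half_gaussian g"
    and "(\<integral>z. g (Im z) \<partial>complex_gaussian) = integral\<^sup>L half_gaussian g"
proof -
  have [measurable]: "g \<in> borel_measurable half_gaussian" using assms(1) by simp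
  have [measurable]: "Re \<in> complex_gaussian \<rightarrow>\<^sub>M half_gaussian"
    "Im \<in> complex_gaussian \<rightarrow>\<^sub>M half_gaussian"
    by (simp_all add: measurable_cong_sets[OF sets_complex_gaussian sets_half_gaussian])
  show "integrable complex_gaussian (\<lambda>z. g (Re z))"
    using assms(2) by (subst (asm) distr_Re_complex_gaussian[symmetric]) (simp add: integrable_distr_eq)
  show "integrable complex_gaussian (\<lambda>z. g (Im z))"
    using assms(2) by (subst (asm) distr_Im_complex_gaussian[symmetric]) (simp add: integrable_distr_eq)
  show "(\<integral>z. g (Re z) \<partial>complex_gaussian) = integral\<^sup>L half_gaussian g"
    by (subst distr_Re_complex_gaussian[symmetric]) (simp add: integral_distr)
  show "(\<integral>z. g (Im z) \<partial>complex_gaussian) = integral\<^sup>L half_gaussian g"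
    by (subst distr_Im_complex_gaussian[symmetric]) (simp add: integral_distr)
qed

lemma complex_gaussian_mean:
  shows "integrable complex_gaussian (\<lambda>z. z)" and "(\<integral>z. z \<partial>complex_gaussian) = 0"
proof -
  have "integrable half_gaussian (\<lambda>x. x)"
    using half_gaussian_moments(1)[of 1] by simp
  note * = complex_gaussian_Re_Im[OF _ this, simplified]
  show i: "integrable complex_gaussian (\<lambda>z. z)"
  proof -
    have "integrable complex_gaussian (\<lambda>z. complex_of_real (Re z) + \<i> * complex_of_real (Im z))"
      using *(1,2) by simp
    then show ?thesis by (simp flip: complex_eq)
  qed
  show "(\<integral>z. z \<partial>complex_gaussian) = 0"
    using *(3,4) half_gaussian_moments(2) i
    by (simp add: complex_eq_iff integral_Re integral_Im)
qed

lemma complex_gaussian_cmod_sq: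
  shows "integrable complex_gaussian (\<lambda>z. (cmod z)\<^sup>2)"
    and "(\<integral>z. (cmod z)\<^sup>2 \<partial>complex_gaussian) = 1"
  using complex_gaussian_Re_Im[OF _ half_gaussian_moments(1)[of 2]] half_gaussian_moments(3)
  by (simp_all add: cmod_power2)

text \<open>The fourth moments of the two parts dominate this square. It gives the squared norm of
  the estimated channel a finite variance.\<close>

lemma integrable_complex_gaussian_cmod_sq_centered:
  "integrable complex_gaussian (\<lambda>z. ((cmod z)\<^sup>2 - 1)\<^sup>2)"
proof (rule Bochner_Integration.integrable_bound)
  interpret prob_space complex_gaussian by (rule prob_space_complex_gaussian)
  note * = complex_gaussian_Re_Im[OF _ half_gaussian_moments(1)[of 4]]
  show "integrable complex_gaussian (\<lambda>z. 4 * (Re z ^ 4 + Im z ^ 4) + 2)"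
    using *(1,2) by simp
  have "((cmod z)\<^sup>2 - 1)\<^sup>2 \<le> 4 * (Re z ^ 4 + Im z ^ 4) + 2" for z
  proof -
    have "((a + b) - 1)\<^sup>2 \<le> 4 * (a\<^sup>2 + b\<^sup>2) + 2" for a b :: real
    proof -
      \<comment> \<open>This sum of squares is exactly the right side minus the left side of the
        claim.\<close>
      have "0 \<le> (a - b)\<^sup>2 * 2 + (a + b + 1)\<^sup>2" by simp
      then show ?thesis by (simp add: power2_eq_square algebra_simps)
    qed
    from this[of "(Re z)\<^sup>2" "(Im z)\<^sup>2"] show ?thesis by (simp add: cmod_power2)
  qed
  then show "AE z in complex_gaussian. norm (((cmod z)\<^sup>2 - 1)\<^sup>2)
      \<le> norm (4 * (Re z ^ 4 + Im z ^ 4) + 2)"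
    by (auto intro: order_trans)
qed measurable

section \<open>Orthogonal sums in L2\<close>

lemma borel_measurable_cnj [measurable]: "cnj \<in> borel_measurable borel"
  by (intro borel_measurable_continuous_onI continuous_intros)

text \<open>Pythagoras in L2: the squared modulus of the sum expands into a double sum whose
  off-diagonal terms integrate to zero. Square integrability of the summands makes every cross
  product integrable.\<close>

lemma second_moment_orthogonal_sum:
  fixes u :: "'i \<Rightarrow> 'a \<Rightarrow> complex"
  assumes "finite A"
    and [measurable]: "\<And>m. m \<in> A \<Longrightarrow> u m \<in> borel_measurable N"
    and sq: "\<And>m. m \<in> A \<Longrightarrow> integrable N (\<lambda>x. (cmod (u m x))\<^sup>2)"
    and orth: "\<And>m m'. m \<in> A \<Longrightarrow> m' \<in> A \<Longrightarrow> m \<noteq> m' \<Longrightarrow> (\<integral>x. u m x * cnj (u m' x) \<partial>N) = 0"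
  shows "integrable N (\<lambda>x. (cmod (\<Sum>m\<in>A. u m x))\<^sup>2)"
    and "(\<integral>x. (cmod (\<Sum>m\<in>A. u m x))\<^sup>2 \<partial>N) = (\<Sum>m\<in>A. \<integral>x. (cmod (u m x))\<^sup>2 \<partial>N)"
proof -
  have eq: "(cmod (\<Sum>m\<in>A. u m x))\<^sup>2 = Re (\<Sum>m\<in>A. \<Sum>m'\<in>A. u m x * cnj (u m' x))" for x
  proof -
    have "(\<Sum>m\<in>A. \<Sum>m'\<in>A. u m x * cnj (u m' x)) = (\<Sum>m\<in>A. u m x) * cnj (\<Sum>m\<in>A. u m x)"
      by (simp only: cnj_sum sum_product)
    also have "\<dots> = complex_of_real ((cmod (\<Sum>m\<in>A. u m x))\<^sup>2)"
      by (simp only: complex_norm_square)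
    finally show ?thesis by simp
  qed
  have int: "integrable N (\<lambda>x. u m x * cnj (u m' x))" if m: "m \<in> A" "m' \<in> A" for m m'
  proof (rule Bochner_Integration.integrable_bound)
    show "integrable N (\<lambda>x. (cmod (u m x))\<^sup>2 + (cmod (u m' x))\<^sup>2)"
      using sq m by simp
    have "a * b \<le> a\<^sup>2 + b\<^sup>2" for a b :: real
    proof -
      have "0 \<le> (a - b)\<^sup>2 + a\<^sup>2 + b\<^sup>2" by simp
      then show ?thesis by (simp add: power2_eq_square algebra_simps)
    qed
    then show "AE x in N. norm (u m x * cnj (u m' x))
        \<le> norm ((cmod (u m x))\<^sup>2 + (cmod (u m' x))\<^sup>2)"
      by (simp add: norm_mult)
  qed (use m in measurable)
  then have int': "integrable N (\<lambda>x. \<Sum>m\<in>A. \<Sum>m'\<in>A. u m x * cnj (u m' x))"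
    by simp
  then show "integrable N (\<lambda>x. (cmod (\<Sum>m\<in>A. u m x))\<^sup>2)"
    unfolding eq by (rule integrable_Re)
  have "(\<integral>x. (cmod (\<Sum>m\<in>A. u m x))\<^sup>2 \<partial>N)
      = Re (\<integral>x. (\<Sum>m\<in>A. \<Sum>m'\<in>A. u m x * cnj (u m' x)) \<partial>N)"
    unfolding eq using int' by (rule integral_Re)
  also have "(\<integral>x. (\<Sum>m\<in>A. \<Sum>m'\<in>A. u m x * cnj (u m' x)) \<partial>N)
      = (\<Sum>m\<in>A. \<Sum>m'\<in>A. \<integral>x. u m x * cnj (u m' x) \<partial>N)"
    using int by (subst Bochner_Integration.integral_sum, simp, intro sum.cong refl Bochner_Integration.integral_sum) auto
  also have "\<dots> = (\<Sum>m\<in>A. \<Sum>m'\<in>A. if m' = m then \<integral>x. u m x * cnj (u m x) \<partial>N else 0)"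
    by (intro sum.cong refl) (use orth in auto)
  also have "\<dots> = (\<Sum>m\<in>A. complex_of_real (\<integral>x. (cmod (u m x))\<^sup>2 \<partial>N))"
    using \<open>finite A\<close>
    by (simp flip: complex_norm_square integral_complex_of_real)
  finally show "(\<integral>x. (cmod (\<Sum>m\<in>A. u m x))\<^sup>2 \<partial>N) = (\<Sum>m\<in>A. \<integral>x. (cmod (u m x))\<^sup>2 \<partial>N)"
    by simp
qed

subsection \<open>Second moments of scattered sums\<close>

lemma prob_space_scatter_law: "prob_space (scatter_law S M)"
  unfolding scatter_law_def by (intro prob_space_PiM prob_space_complex_gaussian)

lemma measurable_scatter_component [measurable]:
  assumes "m \<in> {1..M}" "i \<in> {1..users S}"
  shows "(\<lambda>w. w (m, i)) \<in> borel_measurable (scatter_law S M)"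
proof -
  have "(\<lambda>w. w (m, i)) \<in> scatter_law S M \<rightarrow>\<^sub>M complex_gaussian"
    unfolding scatter_law_def using assms by (intro measurable_component_singleton) auto
  then show ?thesis by (simp add: measurable_cong_sets[OF refl sets_complex_gaussian])
qed

text \<open>Independence of the entries. A function of only some entries is covered by letting the
  other factors be constantly 1.\<close>

lemma scatter_product:
  fixes H :: "nat \<times> nat \<Rightarrow> complex \<Rightarrow> 'b::{real_normed_field,banach,second_countable_topology}"
  assumes "\<And>j. j \<in> {1..M} \<times> {1..users S} \<Longrightarrow> integrable complex_gaussian (H j)"
  shows "integrable (scatter_law S M) (\<lambda>w. \<Prod>j\<in>{1..M} \<times> {1..users S}. H j (w j))"
    and "(\<integral>w. (\<Prod>j\<in>{1..M} \<times> {1..users S}. H j (w j)) \<partial>scatter_law S M)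
       = (\<Prod>j\<in>{1..M} \<times> {1..users S}. integral\<^sup>L complex_gaussian (H j))"
proof -
  interpret prob_space complex_gaussian by (rule prob_space_complex_gaussian)
  interpret product_sigma_finite "\<lambda>_::nat \<times> nat. complex_gaussian" ..
  show "integrable (scatter_law S M) (\<lambda>w. \<Prod>j\<in>{1..M} \<times> {1..users S}. H j (w j))"
    unfolding scatter_law_def using assms by (intro product_integrable_prod) auto
  show "(\<integral>w. (\<Prod>j\<in>{1..M} \<times> {1..users S}. H j (w j)) \<partial>scatter_law S M)
       = (\<Prod>j\<in>{1..M} \<times> {1..users S}. integral\<^sup>L complex_gaussian (H j))"
    unfolding scatter_law_def using assms by (intro product_integral_prod) auto
qed

text \<open>A common source for the antenna sums below: linear forms, energy deviations and cross
  products of two users all arise by taking \<open>F i\<close> constantly 1 for the users that do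
  not take part. A single centered factor \<open>F i0\<close> makes the summands of distinct
  antennas orthogonal.\<close>

lemma scatter_sum_second_moment:
  fixes F :: "nat \<Rightarrow> complex \<Rightarrow> complex" and c :: "nat \<Rightarrow> complex"
    and S :: rician_uplink and M :: nat
  assumes F [measurable]: "\<And>i. F i \<in> borel_measurable borel"
    and sq: "\<And>i. i \<in> {1..users S} \<Longrightarrow> integrable complex_gaussian (\<lambda>x. (cmod (F i x))\<^sup>2)"
    and centered: "i0 \<in> {1..users S}" "integral\<^sup>L complex_gaussian (F i0) = 0"
    and c: "\<And>m. cmod (c m) = 1"
  defines "Q \<equiv> \<lambda>w. (cmod (\<Sum>m=1..M. c m * (\<Prod>i=1..users S. F i (w (m, i)))))\<^sup>2"
  shows "integrable (scatter_law S M) Q"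
    and "integral\<^sup>L (scatter_law S M) Q
       = real M * (\<Prod>i=1..users S. \<integral>x. (cmod (F i x))\<^sup>2 \<partial>complex_gaussian)"
proof -
  interpret prob_space complex_gaussian by (rule prob_space_complex_gaussian)
  let ?J = "{1..M} \<times> {1..users S}"
  define u where "u = (\<lambda>m w. c m * (\<Prod>i=1..users S. F i (w (m, i))))"
  have Q: "Q = (\<lambda>w. (cmod (\<Sum>m=1..M. u m w))\<^sup>2)"
    by (simp add: Q_def u_def)
  have F_int: "integrable complex_gaussian (F i)" if i: "i \<in> {1..users S}" for i
  proof (rule Bochner_Integration.integrable_bound)
    show "integrable complex_gaussian (\<lambda>x. 1 + (cmod (F i x))\<^sup>2)"
      using sq[OF i] by simp
    have "a \<le> 1 + a\<^sup>2" for a :: real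
    proof -
      have "0 \<le> (a - 1)\<^sup>2 + a\<^sup>2 + 1" by simp
      then show ?thesis by (simp add: power2_eq_square algebra_simps)
    qed
    then show "AE x in complex_gaussian. norm (F i x) \<le> norm (1 + (cmod (F i x))\<^sup>2)"
      by simp
  qed (simp add: measurable_cong_sets[OF sets_complex_gaussian refl])
  have [measurable]: "u m \<in> borel_measurable (scatter_law S M)" if "m \<in> {1..M}" for m
    unfolding u_def using that by measurable
  \<comment> \<open>Padding with the factor 1 at all other antennas turns the square into a product
    over all antenna-user pairs, the form required by \<open>scatter_product\<close>.\<close>
  have sq_u: "(\<lambda>w. (cmod (u m w))\<^sup>2)
      = (\<lambda>w. \<Prod>j\<in>?J. (if fst j = m then (cmod (F (snd j) (w j)))\<^sup>2 else 1))"
    if m: "m \<in> {1..M}" for m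
  proof
    fix w
    have "(\<Prod>j\<in>?J. (if fst j = m then (cmod (F (snd j) (w j)))\<^sup>2 else 1))
        = (\<Prod>a=1..M. \<Prod>i=1..users S. (if a = m then (cmod (F i (w (a, i))))\<^sup>2 else 1))"
      by (subst prod.cartesian_product) (auto intro!: prod.cong)
    also have "\<dots> = (\<Prod>a=1..M. if a = m then (\<Prod>i=1..users S. (cmod (F i (w (a, i))))\<^sup>2) else 1)"
      by (intro prod.cong) auto
    also have "\<dots> = (cmod (u m w))\<^sup>2"
      using m by (simp add: u_def norm_mult c prod_norm[symmetric] prod_power_distrib)
    finally show "(cmod (u m w))\<^sup>2 = (\<Prod>j\<in>?J. (if fst j = m then (cmod (F (snd j) (w j)))\<^sup>2 else 1))"
      by simp
  qed
  have sq_int: "integrable complex_gaussian (\<lambda>x. if fst j = m then (cmod (F (snd j) x))\<^sup>2 else 1)"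
    if "j \<in> ?J" for j m
    using that sq by (cases "fst j = m") auto
  have u_int: "integrable (scatter_law S M) (\<lambda>w. (cmod (u m w))\<^sup>2)" if "m \<in> {1..M}" for m
    unfolding sq_u[OF that] using sq_int by (rule scatter_product)
  have u_val: "(\<integral>w. (cmod (u m w))\<^sup>2 \<partial>scatter_law S M)
      = (\<Prod>i=1..users S. \<integral>x. (cmod (F i x))\<^sup>2 \<partial>complex_gaussian)" if m: "m \<in> {1..M}" for m
  proof -
    have "(\<integral>w. (cmod (u m w))\<^sup>2 \<partial>scatter_law S M)
        = (\<Prod>j\<in>?J. \<integral>x. (if fst j = m then (cmod (F (snd j) x))\<^sup>2 else 1) \<partial>complex_gaussian)"
      unfolding sq_u[OF m] using sq_int by (rule scatter_product)
    also have "\<dots> = (\<Prod>a=1..M. \<Prod>i=1..users S.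
        if a = m then \<integral>x. (cmod (F i x))\<^sup>2 \<partial>complex_gaussian else 1)"
      by (subst prod.cartesian_product) (auto intro!: prod.cong simp: prob_space[simplified])
    also have "\<dots> = (\<Prod>a=1..M. if a = m then
        (\<Prod>i=1..users S. \<integral>x. (cmod (F i x))\<^sup>2 \<partial>complex_gaussian) else 1)"
      by (intro prod.cong) auto
    finally show ?thesis using m by simp
  qed
  have orth: "(\<integral>w. u m w * cnj (u m' w) \<partial>scatter_law S M) = 0"
    if m: "m \<in> {1..M}" "m' \<in> {1..M}" "m \<noteq> m'" for m m'
  proof -
    \<comment> \<open>Since \<open>m\<close> and \<open>m'\<close> differ, no entry carries both
      factors, so integrability of each \<open>F i\<close> alone suffices.\<close>
    define H where "H = (\<lambda>(a, i) x. (if a = m then F i x else 1) * (if a = m' then cnj (F i x) else 1))"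
    have H_int: "integrable complex_gaussian (H j)" if "j \<in> ?J" for j
      using that m F_int by (cases j; cases "fst j = m"; cases "fst j = m'") (auto simp: H_def)
    have "(\<Prod>j\<in>?J. H j (w j)) = (\<Prod>a=1..M. (if a = m then \<Prod>i=1..users S. F i (w (a, i)) else 1)
        * (if a = m' then \<Prod>i=1..users S. cnj (F i (w (a, i))) else 1))" for w
    proof -
      have "(\<Prod>j\<in>?J. H j (w j)) = (\<Prod>a=1..M. \<Prod>i=1..users S. H (a, i) (w (a, i)))"
        by (subst prod.cartesian_product) (auto intro!: prod.cong)
      also have "\<dots> = (\<Prod>a=1..M. (if a = m then \<Prod>i=1..users S. F i (w (a, i)) else 1)
        * (if a = m' then \<Prod>i=1..users S. cnj (F i (w (a, i))) else 1))"
        by (intro prod.cong) (auto simp: H_def prod.distrib)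
      finally show ?thesis .
    qed
    then have eq: "u m w * cnj (u m' w) = c m * cnj (c m') * (\<Prod>j\<in>?J. H j (w j))" for w
      using m by (simp add: prod.distrib u_def cnj_prod mult_ac)
    \<comment> \<open>This single vanishing factor annihilates the whole product of
      expectations.\<close>
    have "integral\<^sup>L complex_gaussian (H (m, i0)) = 0"
      using m centered by (simp add: H_def)
    then have "(\<Prod>j\<in>?J. integral\<^sup>L complex_gaussian (H j)) = 0"
      using m centered by (intro prod_zero bexI[of _ "(m, i0)"]) auto
    with scatter_product(2)[OF H_int, of M S] show ?thesis
      by (simp add: eq)
  qed
  show "integrable (scatter_law S M) Q"
    unfolding Q by (intro second_moment_orthogonal_sum u_int orth) auto
  have "integral\<^sup>L (scatter_law S M) Q = (\<Sum>m=1..M. \<integral>w. (cmod (u m w))\<^sup>2 \<partial>scatter_law S M)"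
    unfolding Q by (intro second_moment_orthogonal_sum u_int orth) auto
  also have "\<dots> = real M * (\<Prod>i=1..users S. \<integral>x. (cmod (F i x))\<^sup>2 \<partial>complex_gaussian)"
    by (simp add: u_val)
  finally show "integral\<^sup>L (scatter_law S M) Q
       = real M * (\<Prod>i=1..users S. \<integral>x. (cmod (F i x))\<^sup>2 \<partial>complex_gaussian)" .
qed

subsection \<open>Bounds for an ergodic rate\<close>

text \<open>Intended reading: \<open>Y\<close> is the squared norm of the channel estimate,
  \<open>I\<close> the total cross-talk, \<open>q\<close> the extra noise from the estimation error.
  The parameter \<open>v\<close> bounds the variance of \<open>Y\<close> relative to its squared
  mean, and \<open>d\<close> the expected interference relative to the mean. The upper bound is
  Jensen's inequality; the lower one combines Chebyshev for \<open>Y\<close> with Markov for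
  \<open>I\<close>.\<close>

lemma (in prob_space) ergodic_rate_bounds:
  fixes Y I :: "'a \<Rightarrow> real" and m v d p q :: real
  assumes [measurable]: "Y \<in> borel_measurable M" "I \<in> borel_measurable M"
    and nonneg: "\<And>x. Y x \<ge> 0" "\<And>x. I x \<ge> 0"
    and Y: "integrable M Y" "expectation Y = m" "m > 0"
    and Y_var: "integrable M (\<lambda>x. (Y x - m)\<^sup>2)" "expectation (\<lambda>x. (Y x - m)\<^sup>2) \<le> v * m\<^sup>2"
    and I: "integrable M I" "p * expectation I \<le> d * m"
    and p: "p > 0" and q: "q \<ge> 0"
  defines "sinr \<equiv> \<lambda>x. p * (Y x)\<^sup>2 / (p * I x + Y x * (1 + q))"
  shows "expectation (\<lambda>x. log 2 (1 + sinr x)) \<le> log 2 (1 + p * m)"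
    and "0 < \<epsilon> \<Longrightarrow> \<epsilon> < 1 \<Longrightarrow>
      (1 - v / \<epsilon>\<^sup>2 - d / \<epsilon>) * log 2 (1 + (1 - \<epsilon>) / (\<epsilon> / (1 - \<epsilon>) + 1 + q) * (p * m))
        \<le> expectation (\<lambda>x. log 2 (1 + sinr x))"
proof -
  have s0: "0 \<le> sinr x" for x
    using nonneg p q by (auto simp: sinr_def intro!: divide_nonneg_nonneg)
  \<comment> \<open>Dropping the interference and \<open>q\<close> leaves a denominator of
    \<open>Y x\<close>; where \<open>Y x\<close> is zero, so is the numerator.\<close>
  have s_le: "sinr x \<le> p * Y x" for x
  proof (cases "Y x = 0")
    case False
    then have "Y x > 0" using nonneg(1)[of x] by simp
    then have "Y x \<le> p * I x + Y x * (1 + q)"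
      using nonneg(2)[of x] p q by (simp add: algebra_simps)
    then have "sinr x \<le> p * (Y x)\<^sup>2 / Y x"
      unfolding sinr_def using p \<open>Y x > 0\<close> by (intro divide_left_mono mult_pos_pos) auto
    then show ?thesis using \<open>Y x > 0\<close> by (simp add: power2_eq_square)
  qed (simp add: sinr_def)
  have [measurable]: "sinr \<in> borel_measurable M"
    unfolding sinr_def by measurable
  have log_int: "integrable M (\<lambda>x. log 2 (1 + sinr x))"
  proof (rule Bochner_Integration.integrable_bound)
    show "integrable M (\<lambda>x. p * Y x / ln 2)" using Y by simp
    have "norm (log 2 (1 + sinr x)) \<le> norm (p * Y x / ln 2)" for x
    proof -
      have "0 \<le> ln (1 + sinr x)" using s0[of x] by simp
      moreover have "ln (1 + sinr x) \<le> p * Y x"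
        using ln_add_one_self_le_self[OF s0[of x]] s_le[of x] by linarith
      ultimately show ?thesis
        using nonneg(1)[of x] p by (simp add: log_def divide_right_mono)
    qed
    then show "AE x in M. norm (log 2 (1 + sinr x)) \<le> norm (p * Y x / ln 2)" by simp
  qed measurable
  have pm: "p * m > 0" using p Y by simp
  \<comment> \<open>Jensen by hand: the tangent at \<open>m\<close> of the concave map sending y to
    log 2 (1 + p y) lies above it, and its linear part has expectation zero.\<close>
  have tangent: "log 2 (1 + sinr x) \<le> log 2 (1 + p * m) + (p * Y x - p * m) / ((1 + p * m) * ln 2)" for x
  proof -
    have pY: "p * Y x \<ge> 0" using p nonneg by simp
    have "ln ((1 + p * Y x) / (1 + p * m)) \<le> (1 + p * Y x) / (1 + p * m) - 1"
      using pY pm by (intro ln_le_minus_one divide_pos_pos) linarith+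
    then have "ln (1 + p * Y x) \<le> ln (1 + p * m) + (p * Y x - p * m) / (1 + p * m)"
      using pY pm by (simp add: ln_div field_simps)
    moreover have "ln (1 + sinr x) \<le> ln (1 + p * Y x)"
      using s0[of x] s_le[of x] by simp
    ultimately have "ln (1 + sinr x) \<le> ln (1 + p * m) + (p * Y x - p * m) / (1 + p * m)"
      by linarith
    then have "ln (1 + sinr x) / ln 2 \<le> (ln (1 + p * m) + (p * Y x - p * m) / (1 + p * m)) / ln 2"
      by (intro divide_right_mono) auto
    then show ?thesis by (simp add: log_def add_divide_distrib)
  qed
  have "expectation (\<lambda>x. log 2 (1 + sinr x))
      \<le> expectation (\<lambda>x. log 2 (1 + p * m) + (p * Y x - p * m) / ((1 + p * m) * ln 2))"
    using tangent Y by (intro integral_mono log_int) auto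
  also have "\<dots> = log 2 (1 + p * m)"
    using Y by (simp add: prob_space)
  finally show "expectation (\<lambda>x. log 2 (1 + sinr x)) \<le> log 2 (1 + p * m)" .

  assume e: "0 < \<epsilon>" "\<epsilon> < 1"
  \<comment> \<open>The worst ratio of the SINR to \<open>p * m\<close> on the good event: there
    \<open>Y\<close> is at least (1 - \<epsilon>) m, hence \<open>p * I\<close> is at most
    \<epsilon> m, which is at most \<epsilon> / (1 - \<epsilon>) times \<open>Y\<close>.\<close>
  define a where "a = (1 - \<epsilon>) / (\<epsilon> / (1 - \<epsilon>) + 1 + q)"
  have a0: "a > 0" unfolding a_def using e q by (intro divide_pos_pos add_pos_nonneg) auto
  define G where "G = {x \<in> space M. (Y x - m)\<^sup>2 < (\<epsilon> * m)\<^sup>2 \<and> p * I x < \<epsilon> * m}"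
  have [measurable]: "G \<in> sets M" unfolding G_def by measurable
  have good: "a * (p * m) \<le> sinr x" if "x \<in> G" for x
  proof -
    have "\<bar>Y x - m\<bar> < \<epsilon> * m"
      by (rule power2_less_imp_less) (use that e Y in \<open>auto simp: G_def\<close>)
    then have Ym: "Y x \<ge> (1 - \<epsilon>) * m" by (simp add: algebra_simps)
    moreover have "(1 - \<epsilon>) * m > 0" using e Y by simp
    ultimately have Y0: "Y x > 0" by linarith
    have "p * I x \<le> \<epsilon> / (1 - \<epsilon>) * ((1 - \<epsilon>) * m)" using that e by (simp add: G_def)
    also have "\<dots> \<le> \<epsilon> / (1 - \<epsilon>) * Y x" using Ym e by (intro mult_left_mono) auto
    finally have "p * I x + Y x * (1 + q) \<le> Y x * (\<epsilon> / (1 - \<epsilon>) + 1 + q)"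
      by (simp add: algebra_simps)
    moreover have "0 < p * I x + Y x * (1 + q)"
      using nonneg p q Y0 by (intro add_nonneg_pos mult_pos_pos add_pos_nonneg) auto
    ultimately have "p * (Y x)\<^sup>2 / (Y x * (\<epsilon> / (1 - \<epsilon>) + 1 + q)) \<le> sinr x"
      unfolding sinr_def using p by (intro divide_left_mono) (auto intro: mult_pos_pos)
    moreover have "p * (Y x)\<^sup>2 / (Y x * (\<epsilon> / (1 - \<epsilon>) + 1 + q))
        = p * Y x / (\<epsilon> / (1 - \<epsilon>) + 1 + q)"
      using Y0 by (simp add: power2_eq_square)
    moreover have "p * ((1 - \<epsilon>) * m) / (\<epsilon> / (1 - \<epsilon>) + 1 + q) \<le> p * Y x / (\<epsilon> / (1 - \<epsilon>) + 1 + q)"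
      using Ym p e q by (intro divide_right_mono mult_left_mono) auto
    ultimately show ?thesis by (simp add: a_def mult_ac)
  qed
  let ?L = "log 2 (1 + a * (p * m))"
  have "0 < a * (p * m)" using a0 pm by (rule mult_pos_pos)
  then have L0: "?L \<ge> 0" by (subst zero_le_log_cancel_iff) linarith+
  have "prob {x \<in> space M. (Y x - m)\<^sup>2 \<ge> (\<epsilon> * m)\<^sup>2} \<le> expectation (\<lambda>x. (Y x - m)\<^sup>2) / (\<epsilon> * m)\<^sup>2"
    using e Y by (intro integral_Markov_inequality_measure[OF Y_var(1), of "{}"]) auto
  also have "\<dots> \<le> v * m\<^sup>2 / (\<epsilon> * m)\<^sup>2" using Y_var by (intro divide_right_mono) auto
  also have "\<dots> = v / \<epsilon>\<^sup>2" using Y by (simp add: power_mult_distrib)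
  finally have bad1: "prob {x \<in> space M. (Y x - m)\<^sup>2 \<ge> (\<epsilon> * m)\<^sup>2} \<le> v / \<epsilon>\<^sup>2" .
  have "prob {x \<in> space M. p * I x \<ge> \<epsilon> * m} \<le> expectation (\<lambda>x. p * I x) / (\<epsilon> * m)"
    using e Y I nonneg p by (intro integral_Markov_inequality_measure[of _ _ "{}"]) auto
  also have "\<dots> \<le> d * m / (\<epsilon> * m)" using I e Y by (intro divide_right_mono) auto
  also have "\<dots> = d / \<epsilon>" using Y by simp
  finally have bad2: "prob {x \<in> space M. p * I x \<ge> \<epsilon> * m} \<le> d / \<epsilon>" .
  have "1 - prob G = prob (space M - G)" by (simp add: prob_compl)
  also have "\<dots> \<le> prob ({x \<in> space M. (Y x - m)\<^sup>2 \<ge> (\<epsilon> * m)\<^sup>2} \<union> {x \<in> space M. p * I x \<ge> \<epsilon> * m})"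
    by (intro finite_measure_mono) (auto simp: G_def)
  also have "\<dots> \<le> prob {x \<in> space M. (Y x - m)\<^sup>2 \<ge> (\<epsilon> * m)\<^sup>2} + prob {x \<in> space M. p * I x \<ge> \<epsilon> * m}"
    by (intro measure_Un_le) measurable
  finally have "1 - v / \<epsilon>\<^sup>2 - d / \<epsilon> \<le> prob G" using bad1 bad2 by linarith
  \<comment> \<open>Only \<open>?L\<close> has to be nonnegative here; the coefficient on the left
    may have either sign. Outside \<open>G\<close> the rate is bounded below by 0.\<close>
  then have "(1 - v / \<epsilon>\<^sup>2 - d / \<epsilon>) * ?L \<le> prob G * ?L" using L0 by (rule mult_right_mono)
  also have "\<dots> = expectation (\<lambda>x. indicator G x * ?L)" by simp
  also have "\<dots> \<le> expectation (\<lambda>x. log 2 (1 + sinr x))"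
  proof (intro integral_mono log_int)
    show "indicator G x * ?L \<le> log 2 (1 + sinr x)" for x
    proof (cases "x \<in> G")
      case True
      moreover have "0 < 1 + a * (p * m)" using \<open>0 < a * (p * m)\<close> by linarith
      ultimately show ?thesis using good[OF True] by simp
    next
      case False
      then show ?thesis using s0[of x] by simp
    qed
  qed (auto intro!: integrable_mult_left integrable_real_indicator simp: less_top[symmetric])
  finally show "(1 - v / \<epsilon>\<^sup>2 - d / \<epsilon>) * log 2 (1 + (1 - \<epsilon>) / (\<epsilon> / (1 - \<epsilon>) + 1 + q) * (p * m))
        \<le> expectation (\<lambda>x. log 2 (1 + sinr x))" unfolding a_def .
qed

section \<open>Linear and quadratic forms in the scattered coefficients\<close>

lemma scatter_component:
  fixes f :: "complex \<Rightarrow> 'b::{real_normed_field,banach,second_countable_topology}"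
  assumes f: "integrable complex_gaussian f" and j: "m \<in> {1..M}" "i \<in> {1..users S}"
  shows "integrable (scatter_law S M) (\<lambda>w. f (w (m, i)))"
    and "(\<integral>w. f (w (m, i)) \<partial>scatter_law S M) = integral\<^sup>L complex_gaussian f"
proof -
  interpret prob_space complex_gaussian by (rule prob_space_complex_gaussian)
  let ?J = "{1..M} \<times> {1..users S}"
  \<comment> \<open>With all factors but one equal to 1, the product formula yields the marginal law
    of a single entry.\<close>
  let ?H = "\<lambda>j x. if j = (m, i) then f x else 1"
  have H: "integrable complex_gaussian (?H j)" for j
    using f by (cases "j = (m, i)") auto
  have "(m, i) \<in> ?J" using j by auto
  then have "(\<Prod>j\<in>?J. ?H j (w j)) = f (w (m, i))" for w
    by (subst prod.delta) auto
  moreover have "(\<Prod>j\<in>?J. integral\<^sup>L complex_gaussian (?H j)) = integral\<^sup>L complex_gaussian f"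
  proof -
    have "(\<Prod>j\<in>?J. integral\<^sup>L complex_gaussian (?H j))
        = (\<Prod>j\<in>?J. if j = (m, i) then integral\<^sup>L complex_gaussian f else 1)"
      by (intro prod.cong) (auto simp: prob_space[simplified])
    also have "\<dots> = integral\<^sup>L complex_gaussian f"
      using \<open>(m, i) \<in> ?J\<close> by (subst prod.delta) auto
    finally show ?thesis .
  qed
  ultimately show "integrable (scatter_law S M) (\<lambda>w. f (w (m, i)))"
    and "(\<integral>w. f (w (m, i)) \<partial>scatter_law S M) = integral\<^sup>L complex_gaussian f"
    using scatter_product[where H = ?H and M = M and S = S, OF H] j by simp_all
qed

text \<open>The variance of the exponentially distributed squared modulus, carried as a constant
  through the bounds of order 1 / M.\<close>

definition gaussian_sq_variance :: real where
  "gaussian_sq_variance = (\<integral>z. ((cmod z)\<^sup>2 - 1)\<^sup>2 \<partial>complex_gaussian)"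

lemma gaussian_sq_variance_nonneg: "gaussian_sq_variance \<ge> 0"
  by (simp add: gaussian_sq_variance_def)

text \<open>The weights of modulus 1 stand for line-of-sight phases. Only user \<open>i\<close>
  contributes a factor other than 1, and that factor is centered with unit power.\<close>

lemma scatter_linear_form:
  assumes i: "i \<in> {1..users S}" and c: "\<And>m. cmod (c m) = 1"
  shows "integrable (scatter_law S M) (\<lambda>w. (cmod (\<Sum>m=1..M. c m * w (m, i)))\<^sup>2)"
    and "(\<integral>w. (cmod (\<Sum>m=1..M. c m * w (m, i)))\<^sup>2 \<partial>scatter_law S M) = real M"
    and "integrable (scatter_law S M) (\<lambda>w. \<Sum>m=1..M. c m * w (m, i))"
    and "(\<integral>w. (\<Sum>m=1..M. c m * w (m, i)) \<partial>scatter_law S M) = 0"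
proof -
  interpret prob_space complex_gaussian by (rule prob_space_complex_gaussian)
  define F :: "nat \<Rightarrow> complex \<Rightarrow> complex" where "F = (\<lambda>k x. if k = i then x else 1)"
  have F: "F k \<in> borel_measurable borel" for k
    by (cases "k = i") (auto simp: F_def)
  have sq: "integrable complex_gaussian (\<lambda>x. (cmod (F k x))\<^sup>2)" for k
    using complex_gaussian_cmod_sq(1) by (cases "k = i") (auto simp: F_def)
  have val: "(\<integral>x. (cmod (F k x))\<^sup>2 \<partial>complex_gaussian) = 1" for k
    using complex_gaussian_cmod_sq(2) by (cases "k = i") (auto simp: F_def prob_space[simplified])
  have cent: "integral\<^sup>L complex_gaussian (F i) = 0"
    using complex_gaussian_mean(2) by (simp add: F_def)
  have eq: "(\<Prod>k=1..users S. F k (w (m, k))) = w (m, i)" for w :: "nat \<times> nat \<Rightarrow> complex" and m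
    using i by (simp add: F_def)
  show "integrable (scatter_law S M) (\<lambda>w. (cmod (\<Sum>m=1..M. c m * w (m, i)))\<^sup>2)"
    and "(\<integral>w. (cmod (\<Sum>m=1..M. c m * w (m, i)))\<^sup>2 \<partial>scatter_law S M) = real M"
    using scatter_sum_second_moment[where F = F and c = c and S = S and M = M, OF F sq i cent c]
    unfolding eq val by simp_all
  show "integrable (scatter_law S M) (\<lambda>w. \<Sum>m=1..M. c m * w (m, i))"
    using i by (intro Bochner_Integration.integrable_sum integrable_mult_right
        scatter_component complex_gaussian_mean)
  have "(\<integral>w. (\<Sum>m=1..M. c m * w (m, i)) \<partial>scatter_law S M)
      = (\<Sum>m=1..M. \<integral>w. c m * w (m, i) \<partial>scatter_law S M)"
    using i by (intro Bochner_Integration.integral_sum integrable_mult_right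
        scatter_component complex_gaussian_mean)
  also have "\<dots> = 0"
    using i scatter_component(2)[OF complex_gaussian_mean(1), of _ M i S]
    by (simp add: complex_gaussian_mean(2))
  finally show "(\<integral>w. (\<Sum>m=1..M. c m * w (m, i)) \<partial>scatter_law S M) = 0" .
qed

text \<open>The subtraction of 1 lies inside the sum, so these are sums of independent centered
  variables: the deviation of the scattered energy from its mean \<open>M\<close>.\<close>

lemma scatter_energy_fluctuation:
  assumes i: "i \<in> {1..users S}"
  shows "integrable (scatter_law S M) (\<lambda>w. (\<Sum>m=1..M. (cmod (w (m, i)))\<^sup>2 - 1)\<^sup>2)"
    and "(\<integral>w. (\<Sum>m=1..M. (cmod (w (m, i)))\<^sup>2 - 1)\<^sup>2 \<partial>scatter_law S M) = real M * gaussian_sq_variance"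
    and "integrable (scatter_law S M) (\<lambda>w. \<Sum>m=1..M. (cmod (w (m, i)))\<^sup>2 - 1)"
    and "(\<integral>w. (\<Sum>m=1..M. (cmod (w (m, i)))\<^sup>2 - 1) \<partial>scatter_law S M) = 0"
proof -
  interpret prob_space complex_gaussian by (rule prob_space_complex_gaussian)
  define F :: "nat \<Rightarrow> complex \<Rightarrow> complex" where
    "F = (\<lambda>k x. if k = i then complex_of_real ((cmod x)\<^sup>2 - 1) else 1)"
  have F: "F k \<in> borel_measurable borel" for k
    unfolding F_def by (cases "k = i") measurable
  have norm: "cmod (F k x) ^ 2 = (if k = i then ((cmod x)\<^sup>2 - 1)\<^sup>2 else 1)" for k x
    by (auto simp: F_def norm_of_real simp del: of_real_diff of_real_power)
  have sq: "integrable complex_gaussian (\<lambda>x. (cmod (F k x))\<^sup>2)" for k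
    using integrable_complex_gaussian_cmod_sq_centered by (cases "k = i") (auto simp: norm)
  have val: "(\<integral>x. (cmod (F k x))\<^sup>2 \<partial>complex_gaussian) = (if k = i then gaussian_sq_variance else 1)" for k
    by (auto simp: norm gaussian_sq_variance_def prob_space[simplified])
  have int1: "integrable complex_gaussian (\<lambda>x. (cmod x)\<^sup>2 - 1)"
    using complex_gaussian_cmod_sq(1) by simp
  have mean1: "(\<integral>x. ((cmod x)\<^sup>2 - 1) \<partial>complex_gaussian) = 0"
    using complex_gaussian_cmod_sq by (simp add: prob_space[simplified])
  have cent: "integral\<^sup>L complex_gaussian (F i) = 0"
    using int1 mean1 unfolding F_def by (simp only: if_True refl integral_complex_of_real of_real_0)
  have eq: "(\<Prod>k=1..users S. F k (w (m, k))) = complex_of_real ((cmod (w (m, i)))\<^sup>2 - 1)"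
    for w :: "nat \<times> nat \<Rightarrow> complex" and m
    using i by (simp add: F_def)
  have eq': "(cmod (\<Sum>m=1..M. 1 * (\<Prod>k=1..users S. F k (w (m, k)))))\<^sup>2
      = (\<Sum>m=1..M. (cmod (w (m, i)))\<^sup>2 - 1)\<^sup>2" for w
    unfolding eq mult_1 of_real_sum[symmetric] norm_of_real by simp
  show "integrable (scatter_law S M) (\<lambda>w. (\<Sum>m=1..M. (cmod (w (m, i)))\<^sup>2 - 1)\<^sup>2)"
    using scatter_sum_second_moment(1)[where F = F and c = "\<lambda>_. 1" and S = S and M = M, OF F sq i cent] unfolding eq' by simp
  show "(\<integral>w. (\<Sum>m=1..M. (cmod (w (m, i)))\<^sup>2 - 1)\<^sup>2 \<partial>scatter_law S M) = real M * gaussian_sq_variance"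
    using scatter_sum_second_moment(2)[where F = F and c = "\<lambda>_. 1" and S = S and M = M, OF F sq i cent] i unfolding eq' val by simp
  show "integrable (scatter_law S M) (\<lambda>w. \<Sum>m=1..M. (cmod (w (m, i)))\<^sup>2 - 1)"
    using i by (intro Bochner_Integration.integrable_sum scatter_component(1)[OF int1])
  have "(\<integral>w. (\<Sum>m=1..M. (cmod (w (m, i)))\<^sup>2 - 1) \<partial>scatter_law S M)
      = (\<Sum>m=1..M. \<integral>w. ((cmod (w (m, i)))\<^sup>2 - 1) \<partial>scatter_law S M)"
    using i by (intro Bochner_Integration.integral_sum scatter_component(1)[OF int1])
  also have "\<dots> = 0"
    using i scatter_component(2)[OF int1, of _ M i S] mean1 by simp
  finally show "(\<integral>w. (\<Sum>m=1..M. (cmod (w (m, i)))\<^sup>2 - 1) \<partial>scatter_law S M) = 0" .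
qed

text \<open>For distinct users the two coefficients at an antenna are independent with unit power,
  so each antenna contributes 1 to the second moment; centering of either factor removes the cross
  terms.\<close>

lemma scatter_cross_form:
  assumes i: "i \<in> {1..users S}" and n: "n \<in> {1..users S}" and "i \<noteq> n"
  shows "integrable (scatter_law S M) (\<lambda>w. (cmod (\<Sum>m=1..M. cnj (w (m, n)) * w (m, i)))\<^sup>2)"
    and "(\<integral>w. (cmod (\<Sum>m=1..M. cnj (w (m, n)) * w (m, i)))\<^sup>2 \<partial>scatter_law S M) = real M"
proof -
  interpret prob_space complex_gaussian by (rule prob_space_complex_gaussian)
  define F :: "nat \<Rightarrow> complex \<Rightarrow> complex" where
    "F = (\<lambda>k x. (if k = n then cnj x else 1) * (if k = i then x else 1))"
  have F: "F k \<in> borel_measurable borel" for k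
    unfolding F_def by (cases "k = i"; cases "k = n") (auto simp: assms)
  have norm: "(cmod (F k x))\<^sup>2 = (if k = n \<or> k = i then (cmod x)\<^sup>2 else 1)" for k x
    using \<open>i \<noteq> n\<close> by (auto simp: F_def)
  have sq: "integrable complex_gaussian (\<lambda>x. (cmod (F k x))\<^sup>2)" for k
    unfolding norm using complex_gaussian_cmod_sq(1) by (cases "k = n \<or> k = i") auto
  have val: "(\<integral>x. (cmod (F k x))\<^sup>2 \<partial>complex_gaussian) = 1" for k
    unfolding norm using complex_gaussian_cmod_sq(2)
    by (cases "k = n \<or> k = i") (auto simp: prob_space[simplified])
  have cent: "integral\<^sup>L complex_gaussian (F i) = 0"
    using complex_gaussian_mean(2) \<open>i \<noteq> n\<close> by (simp add: F_def)
  have eq: "(\<Prod>k=1..users S. F k (w (m, k))) = cnj (w (m, n)) * w (m, i)"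
    for w :: "nat \<times> nat \<Rightarrow> complex" and m
    using i n by (simp add: F_def prod.distrib)
  show "integrable (scatter_law S M) (\<lambda>w. (cmod (\<Sum>m=1..M. cnj (w (m, n)) * w (m, i)))\<^sup>2)"
    and "(\<integral>w. (cmod (\<Sum>m=1..M. cnj (w (m, n)) * w (m, i)))\<^sup>2 \<partial>scatter_law S M) = real M"
    using scatter_sum_second_moment[where F = F and c = "\<lambda>_. 1" and S = S and M = M, OF F sq i cent]
    unfolding eq val by simp_all
qed

subsection \<open>The estimated channel\<close>

text \<open>The sines in \<open>phi_defined\<close> vanish exactly when the line-of-sight columns of
  the two users coincide. Excluding this keeps the line-of-sight inner products bounded in
  \<open>M\<close> instead of growing linearly.\<close>

locale rician_user =
  fixes S :: rician_uplink and n :: nat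
  assumes user: "n \<in> {1..users S}"
    and beta_pos: "\<And>i. i \<in> {1..users S} \<Longrightarrow> \<beta> S i > 0"
    and K_nonneg: "\<And>i. i \<in> {1..users S} \<Longrightarrow> Kf S i \<ge> 0"
    and pilots_pos: "pilot_len S > 0"
    and phi_defined: "\<And>i. i \<in> {1..users S} - {n} \<Longrightarrow>
          sin (kd S * (sin (\<theta> S n) - sin (\<theta> S i)) / 2) \<noteq> 0"
begin

lemma eta_bounds:
  assumes "i \<in> {1..users S}" "p > 0"
  shows "0 < \<eta> S p i" "\<eta> S p i \<le> 1"
proof -
  have "pilot_power S p * \<beta> S i > 0"
    using assms beta_pos[of i] pilots_pos by (simp add: pilot_power_def)
  then show "0 < \<eta> S p i" "\<eta> S p i \<le> 1" by (simp_all add: \<eta>_def divide_simps)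
qed

lemma sigma2_bounds:
  assumes "i \<in> {1..users S}" "p > 0"
  shows "0 \<le> \<sigma>2 S p i" "\<sigma>2 S p i \<le> \<beta> S i"
proof -
  have pp: "pilot_power S p * \<beta> S i > 0"
    using assms beta_pos[of i] pilots_pos by (simp add: pilot_power_def)
  have "(1 + pilot_power S p * \<beta> S i) * (Kf S i + 1) \<ge> 1 * 1"
    using pp K_nonneg[of i] assms by (intro mult_mono) auto
  then show "0 \<le> \<sigma>2 S p i" "\<sigma>2 S p i \<le> \<beta> S i"
    using beta_pos[of i] assms
      divide_left_mono[of 1 "(1 + pilot_power S p * \<beta> S i) * (Kf S i + 1)" "\<beta> S i"]
    by (simp_all add: \<sigma>2_def)
qed

lemma sum_sigma2_bounds:
  assumes "p > 0"
  shows "0 \<le> (\<Sum>i=1..users S. \<sigma>2 S p i)" "(\<Sum>i=1..users S. \<sigma>2 S p i) \<le> (\<Sum>i=1..users S. \<beta> S i)"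
  using assms sigma2_bounds by (auto intro!: sum_nonneg sum_mono)

text \<open>The expected squared norm of the estimated channel of user \<open>n\<close>: each
  antenna receives \<open>Kf S n\<close> from the line of sight and \<open>\<eta> S p n\<close> from
  the estimated scattered part, up to the common normalization.\<close>

definition mean_gain :: "nat \<Rightarrow> real \<Rightarrow> real" where
  "mean_gain M p = \<beta> S n / (Kf S n + 1) * (real M * (Kf S n + \<eta> S p n))"

lemma mean_gain_pos: "M > 0 \<Longrightarrow> p > 0 \<Longrightarrow> mean_gain M p > 0"
  using beta_pos[OF user] K_nonneg[OF user] eta_bounds(1)[OF user, of p]
  by (auto simp: mean_gain_def intro!: mult_pos_pos divide_pos_pos add_nonneg_pos)

lemma cmod_los [simp]: "cmod (los S m i) = 1"
proof -
  have "los S m i = exp (\<i> * complex_of_real (- ((real m - 1) * kd S * sin (\<theta> S i))))"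
    by (simp add: los_def)
  then show ?thesis by (simp only: norm_exp_i_times)
qed

lemma cmod_cnj_los: "cmod (cnj (los S m i)) = 1"
  by simp

lemma cmod_g_hat_sq:
  assumes "i \<in> {1..users S}" "p > 0"
  shows "(cmod (g_hat S p w m i))\<^sup>2 = \<beta> S i / (Kf S i + 1)
    * (Kf S i + 2 * (sqrt (Kf S i) * sqrt (\<eta> S p i)) * Re (cnj (los S m i) * w (m, i))
       + \<eta> S p i * (cmod (w (m, i)))\<^sup>2)"
proof -
  have "(Re (los S m i))\<^sup>2 + (Im (los S m i))\<^sup>2 = 1"
    using cmod_power2[of "los S m i"] by simp
  moreover have "(cmod (of_real a * l + of_real b * z))\<^sup>2
      = a\<^sup>2 * ((Re l)\<^sup>2 + (Im l)\<^sup>2) + 2 * (a * b) * Re (cnj l * z) + b\<^sup>2 * (cmod z)\<^sup>2"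
    for a b :: real and l z :: complex
    unfolding cmod_power2 by (simp add: power2_eq_square algebra_simps)
  ultimately have "(cmod (of_real (sqrt (Kf S i)) * los S m i + of_real (sqrt (\<eta> S p i)) * w (m, i)))\<^sup>2
      = Kf S i + 2 * (sqrt (Kf S i) * sqrt (\<eta> S p i)) * Re (cnj (los S m i) * w (m, i))
       + \<eta> S p i * (cmod (w (m, i)))\<^sup>2"
    using assms K_nonneg eta_bounds(1)[OF assms] by simp
  moreover have "0 \<le> \<beta> S i / (Kf S i + 1)"
    using assms beta_pos[of i] K_nonneg[of i] by simp
  ultimately show ?thesis
    unfolding g_hat_def norm_mult power_mult_distrib by simp
qed

text \<open>The squared norm is split into its mean and two centered fluctuations: the interaction
  of line of sight with scatter, and the energy deviation of the scatter.\<close>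

lemma g_inner_self:
  assumes "p > 0"
  shows "cmod (g_inner S M p w n n) = mean_gain M p + \<beta> S n / (Kf S n + 1)
    * (2 * (sqrt (Kf S n) * sqrt (\<eta> S p n)) * Re (\<Sum>m=1..M. cnj (los S m n) * w (m, n))
       + \<eta> S p n * (\<Sum>m=1..M. (cmod (w (m, n)))\<^sup>2 - 1))"
proof -
  have "g_inner S M p w n n = complex_of_real (\<Sum>m=1..M. (cmod (g_hat S p w m n))\<^sup>2)"
    unfolding g_inner_def of_real_sum by (intro sum.cong refl) (simp only: complex_norm_square mult.commute)
  then have "cmod (g_inner S M p w n n) = (\<Sum>m=1..M. (cmod (g_hat S p w m n))\<^sup>2)"
    by (simp only: norm_of_real) (simp add: sum_nonneg)
  then show ?thesis
    by (simp add: cmod_g_hat_sq[OF user assms] mean_gain_def sum.distrib sum_distrib_left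
        sum_subtractf algebra_simps)
qed

lemma measurable_g_hat:
  assumes "m \<in> {1..M}" "i \<in> {1..users S}"
  shows "(\<lambda>w. g_hat S p w m i) \<in> borel_measurable (scatter_law S M)"
  unfolding g_hat_def using assms by measurable

lemma measurable_g_inner [measurable]:
  assumes "i \<in> {1..users S}"
  shows "(\<lambda>w. g_inner S M p w n i) \<in> borel_measurable (scatter_law S M)"
proof -
  have *: "(\<lambda>w. cnj (g_hat S p w m n)) \<in> borel_measurable (scatter_law S M)" if "m \<in> {1..M}" for m
    using measurable_compose[OF measurable_g_hat[OF that user] borel_measurable_cnj] .
  show ?thesis
    unfolding g_inner_def using * assms
    by (intro borel_measurable_sum borel_measurable_times measurable_g_hat) auto
qed

text \<open>Both fluctuations have second moment of order \<open>M\<close>, while the squared mean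
  is of order \<open>M\<^sup>2\<close>. The constant in the relative variance is independent of
  \<open>p\<close>; this matters because \<eta>, and for K_n = 0 the mean per antenna itself,
  vanishes with \<open>p\<close>.\<close>

lemma g_inner_self_moments:
  assumes p: "p > 0" and M: "M > 0"
  defines "Y \<equiv> \<lambda>w. cmod (g_inner S M p w n n)"
  shows "integrable (scatter_law S M) Y"
    and "integral\<^sup>L (scatter_law S M) Y = mean_gain M p"
    and "integrable (scatter_law S M) (\<lambda>w. (Y w - mean_gain M p)\<^sup>2)"
    and "(\<integral>w. (Y w - mean_gain M p)\<^sup>2 \<partial>scatter_law S M)
      \<le> (2 + 2 * gaussian_sq_variance) / real M * (mean_gain M p)\<^sup>2"
proof -
  interpret prob_space "scatter_law S M" by (rule prob_space_scatter_law)
  let ?L = "\<beta> S n / (Kf S n + 1)" and ?K = "Kf S n" and ?h = "\<eta> S p n"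
  let ?V = gaussian_sq_variance
  define T where "T w = (\<Sum>m=1..M. cnj (los S m n) * w (m, n))" for w :: "nat \<times> nat \<Rightarrow> complex"
  define U where "U w = (\<Sum>m=1..M. (cmod (w (m, n)))\<^sup>2 - 1)" for w :: "nat \<times> nat \<Rightarrow> complex"
  note T = scatter_linear_form[where c = "\<lambda>m. cnj (los S m n)" and M = M, OF user cmod_cnj_los,
      folded T_def]
  note U = scatter_energy_fluctuation[where M = M, OF user, folded U_def]
  have h: "0 < ?h" "?h \<le> 1" using eta_bounds[OF user p] by auto
  have K: "0 \<le> ?K" using K_nonneg[OF user] .
  have Y: "Y w = mean_gain M p + ?L * (2 * (sqrt ?K * sqrt ?h) * Re (T w) + ?h * U w)" for w
    unfolding Y_def g_inner_self[OF p] T_def U_def by simp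
  have ReT: "integrable (scatter_law S M) (\<lambda>w. Re (T w))" "expectation (\<lambda>w. Re (T w)) = 0"
    using T(3,4) by (simp_all add: integral_Re)
  show "integrable (scatter_law S M) Y" "expectation Y = mean_gain M p"
    unfolding Y using ReT U by (simp_all add: prob_space)
  have dev: "(Y w - mean_gain M p)\<^sup>2 \<le> ?L\<^sup>2 * (8 * (?K * ?h) * (cmod (T w))\<^sup>2 + 2 * ?h\<^sup>2 * (U w)\<^sup>2)" for w
  proof -
    have sq: "(a + b)\<^sup>2 \<le> 2 * a\<^sup>2 + 2 * b\<^sup>2" for a b :: real
      using zero_le_power2[of "a - b"] by (simp add: power2_eq_square algebra_simps)
    have "(2 * (sqrt ?K * sqrt ?h) * Re (T w) + ?h * U w)\<^sup>2
        \<le> 2 * (2 * (sqrt ?K * sqrt ?h) * Re (T w))\<^sup>2 + 2 * (?h * U w)\<^sup>2" by (rule sq)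
    also have "\<dots> = 8 * (?K * ?h) * (Re (T w))\<^sup>2 + 2 * ?h\<^sup>2 * (U w)\<^sup>2"
      using h K by (simp add: power_mult_distrib)
    also have "\<dots> \<le> 8 * (?K * ?h) * (cmod (T w))\<^sup>2 + 2 * ?h\<^sup>2 * (U w)\<^sup>2"
      using h K by (intro add_right_mono mult_left_mono) (auto simp: cmod_power2)
    finally show ?thesis
      unfolding Y add_diff_cancel_left' power_mult_distrib[of ?L] by (rule mult_left_mono) simp
  qed
  have dom: "integrable (scatter_law S M)
      (\<lambda>w. ?L\<^sup>2 * (8 * (?K * ?h) * (cmod (T w))\<^sup>2 + 2 * ?h\<^sup>2 * (U w)\<^sup>2))"
    using T(1) U(1) by simp
  have [measurable]: "Y \<in> borel_measurable (scatter_law S M)"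
    using \<open>integrable (scatter_law S M) Y\<close> by simp
  show int: "integrable (scatter_law S M) (\<lambda>w. (Y w - mean_gain M p)\<^sup>2)"
  proof (rule Bochner_Integration.integrable_bound[OF dom])
    show "AE w in scatter_law S M. norm ((Y w - mean_gain M p)\<^sup>2)
        \<le> norm (?L\<^sup>2 * (8 * (?K * ?h) * (cmod (T w))\<^sup>2 + 2 * ?h\<^sup>2 * (U w)\<^sup>2))"
      using order_trans[OF dev abs_ge_self] by (intro AE_I2) (simp only: real_norm_def abs_power2 power2_abs)
  qed measurable
  have "expectation (\<lambda>w. (Y w - mean_gain M p)\<^sup>2)
      \<le> expectation (\<lambda>w. ?L\<^sup>2 * (8 * (?K * ?h) * (cmod (T w))\<^sup>2 + 2 * ?h\<^sup>2 * (U w)\<^sup>2))"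
    by (intro integral_mono int dom dev)
  also have "\<dots> = ?L\<^sup>2 * (8 * (?K * ?h) * real M + 2 * ?h\<^sup>2 * (real M * ?V))"
    using T(1,2) U(1,2) by simp
  also have "\<dots> \<le> ?L\<^sup>2 * ((2 + 2 * ?V) * real M * (?K + ?h)\<^sup>2)"
  proof (rule mult_left_mono)
    \<comment> \<open>The arithmetic-geometric inequality lets the squared mean absorb the
      interaction term for every size of \<open>?h\<close>.\<close>
    have "4 * (?K * ?h) \<le> (?K + ?h)\<^sup>2"
      using zero_le_power2[of "?K - ?h"] by (simp add: power2_eq_square algebra_simps)
    then have "8 * (?K * ?h) * real M \<le> 2 * (?K + ?h)\<^sup>2 * real M"
      by (intro mult_right_mono) auto
    moreover have "2 * ?h\<^sup>2 * (real M * ?V) \<le> 2 * (?K + ?h)\<^sup>2 * (real M * ?V)"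
      using h K gaussian_sq_variance_nonneg by (intro mult_right_mono mult_left_mono power_mono) auto
    ultimately show "8 * (?K * ?h) * real M + 2 * ?h\<^sup>2 * (real M * ?V)
        \<le> (2 + 2 * ?V) * real M * (?K + ?h)\<^sup>2"
      by (simp add: algebra_simps)
  qed simp
  also have "\<dots> = (2 + 2 * ?V) / real M * (mean_gain M p)\<^sup>2"
    using M by (simp add: mean_gain_def power_mult_distrib power_divide) (simp add: power2_eq_square)
  finally show "expectation (\<lambda>w. (Y w - mean_gain M p)\<^sup>2)
      \<le> (2 + 2 * gaussian_sq_variance) / real M * (mean_gain M p)\<^sup>2" .
qed

text \<open>The bound 2 / |z - 1| for partial sums of the geometric series in z, the phase factor
  gained from one antenna to the next.\<close>

definition los_bound :: "nat \<Rightarrow> real" where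
  "los_bound i = 2 / cmod (exp (\<i> * complex_of_real (kd S * (sin (\<theta> S n) - sin (\<theta> S i)))) - 1)"

lemma los_inner_bound:
  assumes "i \<in> {1..users S} - {n}"
  shows "cmod (\<Sum>m=1..M. cnj (los S m n) * los S m i) \<le> los_bound i"
proof -
  define x where "x = kd S * (sin (\<theta> S n) - sin (\<theta> S i))"
  define z where "z = exp (\<i> * complex_of_real x)"
  have "z \<noteq> 1"
  proof
    assume "z = 1"
    then obtain k :: int where "x = of_int (2 * k) * pi"
      by (auto simp: z_def exp_eq_1)
    then have "sin (x / 2) = 0" by (simp add: sin_zero_iff_int2)
    then show False using phi_defined[OF assms] by (simp add: x_def)
  qed
  \<comment> \<open>Antennas are numbered from 1, so the truncated subtraction is exact and the
    exponents run from 0 to \<open>M\<close> - 1.\<close>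
  have los_term: "cnj (los S m n) * los S m i = z ^ (m - 1)" if "m \<in> {1..M}" for m
  proof -
    have "cnj (los S m n) * los S m i = exp (of_nat (m - 1) * (\<i> * complex_of_real x))"
      using that by (simp add: los_def exp_cnj exp_add[symmetric] x_def of_nat_diff algebra_simps)
    then show ?thesis unfolding z_def by (simp only: exp_of_nat_mult)
  qed
  have "(\<Sum>m=1..M. cnj (los S m n) * los S m i) = (\<Sum>m=1..M. z ^ (m - 1))"
    using los_term by (intro sum.cong) auto
  also have "\<dots> = (\<Sum>k<M. z ^ k)"
    by (rule sum.reindex_bij_witness[of _ Suc "\<lambda>m. m - 1"]) auto
  also have "\<dots> = (z ^ M - 1) / (z - 1)"
    using \<open>z \<noteq> 1\<close> by (rule geometric_sum)
  finally have "cmod (\<Sum>m=1..M. cnj (los S m n) * los S m i) = cmod (z ^ M - 1) / cmod (z - 1)"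
    by (simp add: norm_divide)
  also have "\<dots> \<le> 2 / cmod (z - 1)"
  proof (rule divide_right_mono)
    have "cmod z = 1" by (simp add: z_def)
    then show "cmod (z ^ M - 1) \<le> 2"
      using norm_triangle_ineq4[of "z ^ M" 1] by (simp add: norm_power)
  qed simp
  finally show ?thesis by (simp add: los_bound_def z_def x_def)
qed

text \<open>The factor 4 comes from squaring a sum of four terms; the bracket collects the bounded
  line-of-sight part and the scattered parts.\<close>

definition interference_const :: "nat \<Rightarrow> real" where
  "interference_const i = 4 * (\<beta> S i / (Kf S i + 1)) * (Kf S i * (los_bound i)\<^sup>2 + Kf S i + 1)"

text \<open>Line of sight and scatter of the two users give four products. The purely line-of-sight
  one is bounded in \<open>M\<close>, the other three have second moment \<open>M\<close>. Every
  coefficient carries \<open>Kf S n\<close> or \<open>\<eta> S p n\<close>, so a fixed multiple of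
  the mean gain suffices, uniformly in \<open>p\<close> and \<open>M\<close>.\<close>

lemma g_inner_other_moment:
  assumes p: "p > 0" and M: "M > 0" and i: "i \<in> {1..users S} - {n}"
  shows "integrable (scatter_law S M) (\<lambda>w. (cmod (g_inner S M p w n i))\<^sup>2)"
    and "(\<integral>w. (cmod (g_inner S M p w n i))\<^sup>2 \<partial>scatter_law S M) \<le> interference_const i * mean_gain M p"
proof -
  interpret prob_space "scatter_law S M" by (rule prob_space_scatter_law)
  let ?Ln = "\<beta> S n / (Kf S n + 1)" and ?Li = "\<beta> S i / (Kf S i + 1)"
  let ?K = "Kf S n" and ?Ki = "Kf S i" and ?h = "\<eta> S p n" and ?hi = "\<eta> S p i"
  have iu: "i \<in> {1..users S}" "i \<noteq> n" using i by auto
  have h: "0 < ?h" "?h \<le> 1" "0 < ?hi" "?hi \<le> 1" using eta_bounds[OF user p] eta_bounds[OF iu(1) p] by auto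
  have K: "0 \<le> ?K" "0 \<le> ?Ki" using K_nonneg[OF user] K_nonneg[OF iu(1)] by auto
  have L: "0 \<le> ?Ln" "0 \<le> ?Li" using K beta_pos[OF user] beta_pos[OF iu(1)] by simp_all
  define T0 where "T0 = (\<Sum>m=1..M. cnj (los S m n) * los S m i)"
  define T1 where "T1 w = (\<Sum>m=1..M. cnj (los S m i) * w (m, n))" for w :: "nat \<times> nat \<Rightarrow> complex"
  define T2 where "T2 w = (\<Sum>m=1..M. cnj (los S m n) * w (m, i))" for w :: "nat \<times> nat \<Rightarrow> complex"
  define T3 where "T3 w = (\<Sum>m=1..M. cnj (w (m, n)) * w (m, i))" for w :: "nat \<times> nat \<Rightarrow> complex"
  note T1 = scatter_linear_form[where c = "\<lambda>m. cnj (los S m i)" and M = M, OF user cmod_cnj_los,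
      folded T1_def]
  note T2 = scatter_linear_form[where c = "\<lambda>m. cnj (los S m n)" and M = M, OF iu(1) cmod_cnj_los,
      folded T2_def]
  note T3 = scatter_cross_form[where M = M, OF iu(1) user iu(2), folded T3_def]
  \<comment> \<open>The form \<open>T1\<close> enters conjugated because the scattered coefficient
    of user \<open>n\<close> is the conjugated factor in the inner product.\<close>
  have eq: "g_inner S M p w n i = of_real (sqrt ?Ln * sqrt ?Li)
      * (of_real (sqrt ?K * sqrt ?Ki) * T0 + of_real (sqrt ?h * sqrt ?Ki) * cnj (T1 w)
         + of_real (sqrt ?K * sqrt ?hi) * T2 w + of_real (sqrt ?h * sqrt ?hi) * T3 w)" for w
    unfolding g_inner_def T0_def T1_def T2_def T3_def g_hat_def
    by (simp add: sum_distrib_left sum.distrib[symmetric] algebra_simps)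
  define B where "B w = ?Ln * ?Li * (4 * (?K * ?Ki * (cmod T0)\<^sup>2 + ?h * ?Ki * (cmod (T1 w))\<^sup>2
      + ?K * ?hi * (cmod (T2 w))\<^sup>2 + ?h * ?hi * (cmod (T3 w))\<^sup>2))" for w
  have le: "(cmod (g_inner S M p w n i))\<^sup>2 \<le> B w" for w
  proof -
    have sq: "(a + b + c + d)\<^sup>2 \<le> 4 * (a\<^sup>2 + b\<^sup>2 + c\<^sup>2 + d\<^sup>2)" for a b c d :: real
    proof -
      \<comment> \<open>The pairwise differences account exactly for the gap in this instance of
        Cauchy-Schwarz.\<close>
      have "0 \<le> (a - b)\<^sup>2 + (a - c)\<^sup>2 + (a - d)\<^sup>2 + (b - c)\<^sup>2 + (b - d)\<^sup>2 + (c - d)\<^sup>2" by simp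
      then show ?thesis by (simp add: power2_eq_square algebra_simps)
    qed
    let ?a = "complex_of_real (sqrt ?K * sqrt ?Ki) * T0" and ?b = "complex_of_real (sqrt ?h * sqrt ?Ki) * cnj (T1 w)"
      and ?c = "complex_of_real (sqrt ?K * sqrt ?hi) * T2 w" and ?d = "complex_of_real (sqrt ?h * sqrt ?hi) * T3 w"
    have "cmod (?a + ?b + ?c + ?d) \<le> cmod ?a + cmod ?b + cmod ?c + cmod ?d"
      by (intro norm_triangle_mono order_refl)
    then have "(cmod (?a + ?b + ?c + ?d))\<^sup>2 \<le> (cmod ?a + cmod ?b + cmod ?c + cmod ?d)\<^sup>2"
      by (rule power_mono) simp
    also have "\<dots> \<le> 4 * ((cmod ?a)\<^sup>2 + (cmod ?b)\<^sup>2 + (cmod ?c)\<^sup>2 + (cmod ?d)\<^sup>2)" by (rule sq)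
    also have "\<dots> = 4 * (?K * ?Ki * (cmod T0)\<^sup>2 + ?h * ?Ki * (cmod (T1 w))\<^sup>2
      + ?K * ?hi * (cmod (T2 w))\<^sup>2 + ?h * ?hi * (cmod (T3 w))\<^sup>2)"
      unfolding norm_mult norm_of_real power_mult_distrib power2_abs
      using h K by simp
    finally have "?Ln * ?Li * (cmod (?a + ?b + ?c + ?d))\<^sup>2 \<le> B w"
      unfolding B_def by (rule mult_left_mono) (intro mult_nonneg_nonneg L)
    moreover have "(cmod (g_inner S M p w n i))\<^sup>2 = ?Ln * ?Li * (cmod (?a + ?b + ?c + ?d))\<^sup>2"
      unfolding eq norm_mult[of "of_real _" "_ + _"] norm_of_real power_mult_distrib power2_abs
      using L by (simp only: real_sqrt_pow2)
    ultimately show ?thesis by simp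
  qed
  have B_int: "integrable (scatter_law S M) B"
    unfolding B_def using T1(1) T2(1) T3(1) by simp
  show int: "integrable (scatter_law S M) (\<lambda>w. (cmod (g_inner S M p w n i))\<^sup>2)"
  proof (rule Bochner_Integration.integrable_bound[OF B_int])
    show "AE w in scatter_law S M. norm ((cmod (g_inner S M p w n i))\<^sup>2) \<le> norm (B w)"
      using order_trans[OF le abs_ge_self] by (intro AE_I2) simp
  qed (use iu in measurable)
  have "expectation (\<lambda>w. (cmod (g_inner S M p w n i))\<^sup>2) \<le> expectation B"
    by (intro integral_mono int B_int le)
  also have "\<dots> = ?Ln * ?Li * (4 * (?K * ?Ki * (cmod T0)\<^sup>2 + ?h * ?Ki * real M
      + ?K * ?hi * real M + ?h * ?hi * real M))"
    unfolding B_def using T1(1,2) T2(1,2) T3(1,2) by (simp add: prob_space)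
  also have "\<dots> \<le> ?Ln * ?Li * (4 * ((?K + ?h) * real M * (?Ki * (los_bound i)\<^sup>2 + ?Ki + 1)))"
  proof (intro mult_left_mono)
    have "(cmod T0)\<^sup>2 \<le> (los_bound i)\<^sup>2"
      unfolding T0_def by (intro power_mono los_inner_bound i) simp
    \<comment> \<open>As \<open>M\<close> is at least 1, the bounded term can be charged to the same
      factor as the growing ones.\<close>
    then have "?K * (cmod T0)\<^sup>2 \<le> (?K + ?h) * real M * (los_bound i)\<^sup>2"
      using K h M mult_mono[of "?K" "?K + ?h" 1 "real M"] by (intro mult_mono) auto
    from mult_right_mono[OF this K(2)]
    have "?K * ?Ki * (cmod T0)\<^sup>2 \<le> (?K + ?h) * real M * (los_bound i)\<^sup>2 * ?Ki"
      by (simp only: mult_ac)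
    moreover have "?h * ?Ki * real M \<le> (?K + ?h) * ?Ki * real M"
      using K h by (intro mult_right_mono) auto
    moreover have "(?K + ?h) * ?hi * real M \<le> (?K + ?h) * 1 * real M"
      using K h by (intro mult_right_mono mult_left_mono) auto
    ultimately show "?K * ?Ki * (cmod T0)\<^sup>2 + ?h * ?Ki * real M + ?K * ?hi * real M + ?h * ?hi * real M
        \<le> (?K + ?h) * real M * (?Ki * (los_bound i)\<^sup>2 + ?Ki + 1)"
      by (simp add: algebra_simps)
  qed ((rule mult_nonneg_nonneg[OF L] | simp)+)
  also have "\<dots> = interference_const i * mean_gain M p"
    by (simp add: interference_const_def mean_gain_def mult_ac)
  finally show "expectation (\<lambda>w. (cmod (g_inner S M p w n i))\<^sup>2) \<le> interference_const i * mean_gain M p" .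
qed

lemma exact_rate_bounds:
  assumes p: "p > 0" and M: "M > 0"
  defines "q \<equiv> p * (\<Sum>i=1..users S. \<sigma>2 S p i)"
  shows "exact_unquantized_rate S M p n \<le> log 2 (1 + p * mean_gain M p)"
    and "0 < \<epsilon> \<Longrightarrow> \<epsilon> < 1 \<Longrightarrow>
      (1 - (2 + 2 * gaussian_sq_variance) / real M / \<epsilon>\<^sup>2
         - p * (\<Sum>i\<in>{1..users S} - {n}. interference_const i) / \<epsilon>)
        * log 2 (1 + (1 - \<epsilon>) / (\<epsilon> / (1 - \<epsilon>) + 1 + q) * (p * mean_gain M p))
      \<le> exact_unquantized_rate S M p n"
proof -
  interpret prob_space "scatter_law S M" by (rule prob_space_scatter_law)
  define Y where "Y w = (cmod (g_inner S M p w n n))" for w :: "nat \<times> nat \<Rightarrow> complex"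
  define I where "I w = (\<Sum>i\<in>{1..users S} - {n}. (cmod (g_inner S M p w n i))\<^sup>2)" for w :: "nat \<times> nat \<Rightarrow> complex"
  note Y = g_inner_self_moments[OF p M, folded Y_def]
  have I_int: "integrable (scatter_law S M) I"
    unfolding I_def using g_inner_other_moment(1)[OF p M] by (intro Bochner_Integration.integrable_sum)
  have "expectation I = (\<Sum>i\<in>{1..users S} - {n}. expectation (\<lambda>w. (cmod (g_inner S M p w n i))\<^sup>2))"
    unfolding I_def using g_inner_other_moment(1)[OF p M] by (intro Bochner_Integration.integral_sum) auto
  also have "\<dots> \<le> (\<Sum>i\<in>{1..users S} - {n}. interference_const i * mean_gain M p)"
    by (intro sum_mono g_inner_other_moment p M)
  finally have I_le: "p * expectation I \<le> p * (\<Sum>i\<in>{1..users S} - {n}. interference_const i) * mean_gain M p"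
    using p by (simp add: sum_distrib_right mult_left_mono mult.assoc)
  have meas: "Y \<in> borel_measurable (scatter_law S M)" "I \<in> borel_measurable (scatter_law S M)"
    using Y(1) I_int by auto
  have nonneg: "Y w \<ge> 0" "I w \<ge> 0" for w
    by (auto simp: Y_def I_def intro!: sum_nonneg)
  have q: "q \<ge> 0" unfolding q_def using p sum_sigma2_bounds(1)[OF p] by simp
  have eq: "exact_unquantized_rate S M p n
      = expectation (\<lambda>w. log 2 (1 + p * (Y w)\<^sup>2 / (p * I w + Y w * (1 + q))))"
    by (simp add: exact_unquantized_rate_def exact_sinr_def Y_def I_def q_def)
  note * = ergodic_rate_bounds[OF meas nonneg Y(1,2) mean_gain_pos[OF M p] Y(3,4) I_int I_le p q]
  show "exact_unquantized_rate S M p n \<le> log 2 (1 + p * mean_gain M p)"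
    unfolding eq by (rule *(1))
  show "(1 - (2 + 2 * gaussian_sq_variance) / real M / \<epsilon>\<^sup>2
         - p * (\<Sum>i\<in>{1..users S} - {n}. interference_const i) / \<epsilon>)
        * log 2 (1 + (1 - \<epsilon>) / (\<epsilon> / (1 - \<epsilon>) + 1 + q) * (p * mean_gain M p))
      \<le> exact_unquantized_rate S M p n" if "0 < \<epsilon>" "\<epsilon> < 1"
    unfolding eq using that by (rule *(2))
qed

end

subsection \<open>The closed-form rate\<close>

text \<open>The argument of the logarithm lies between (1 + x) / (1 + d) and (1 + x) (1 + e). The
  resulting additive errors do not involve x, so they stay small even when x diverges.\<close>

lemma log_perturbed_ratio_bounds:
  fixes x e d :: real
  assumes "x \<ge> 0" "e \<ge> 0" "d \<ge> 0"
  shows "log 2 (1 + x) - log 2 (1 + d) \<le> log 2 (1 + (x + e) / (1 + d))"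
    and "log 2 (1 + (x + e) / (1 + d)) \<le> log 2 (1 + x) + log 2 (1 + e)"
proof -
  have "log 2 (1 + x) - log 2 (1 + d) = log 2 ((1 + x) / (1 + d))"
    using assms by (simp add: log_divide)
  also have "\<dots> \<le> log 2 (1 + (x + e) / (1 + d))"
  proof -
    have "(1 + x) / (1 + d) \<le> 1 + (x + e) / (1 + d)"
      using assms by (simp add: field_simps)
    moreover have "0 < (1 + x) / (1 + d)" using assms by (intro divide_pos_pos) auto
    ultimately show ?thesis by simp
  qed
  finally show "log 2 (1 + x) - log 2 (1 + d) \<le> log 2 (1 + (x + e) / (1 + d))" .
  have "1 + (x + e) / (1 + d) \<le> (1 + x) * (1 + e)"
  proof -
    have "(x + e) / (1 + d) \<le> (x + e) / 1" using assms by (intro divide_left_mono) auto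
    moreover have "0 \<le> x * e" using assms by simp
    ultimately show ?thesis by (simp add: algebra_simps)
  qed
  moreover have "0 < 1 + (x + e) / (1 + d)" using assms by (intro add_pos_nonneg) auto
  ultimately have "log 2 (1 + (x + e) / (1 + d)) \<le> log 2 ((1 + x) * (1 + e))" by simp
  also have "\<dots> = log 2 (1 + x) + log 2 (1 + e)"
    using assms by (simp add: log_mult)
  finally show "log 2 (1 + (x + e) / (1 + d)) \<le> log 2 (1 + x) + log 2 (1 + e)" .
qed

context rician_user
begin

definition phi_bound :: "nat \<Rightarrow> real" where
  "phi_bound i = 1 / \<bar>sin (kd S * (sin (\<theta> S n) - sin (\<theta> S i)) / 2)\<bar>"

lemma phi_sq_le: "(\<phi> S n i m)\<^sup>2 \<le> (phi_bound i)\<^sup>2"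
proof -
  have "\<bar>\<phi> S n i m\<bar> \<le> phi_bound i"
    unfolding \<phi>_def phi_bound_def abs_divide by (intro divide_right_mono) auto
  then show ?thesis by (simp add: abs_le_square_iff[symmetric] phi_bound_def)
qed

text \<open>The factor K_n + \<eta>_n must survive in the bound: for K_n = 0 the leading part of the
  rate's denominator is itself proportional to \<eta>_n, which vanishes with \<open>p\<close>. The
  term with \<phi> carries K_n and is bounded in the antenna numbers; the remaining one grows at
  most linearly.\<close>

lemma Delta3_bounds:
  assumes p: "p > 0" and i: "i \<in> {1..users S} - {n}" and al: "0 \<le> \<alpha>" "\<alpha> \<le> 1"
    and M: "M0 + M1 > 0"
  shows "0 \<le> \<Delta>3 S \<alpha> M0 M1 p n i"
    and "\<Delta>3 S \<alpha> M0 M1 p n i \<le> \<beta> S i / (Kf S i + 1) * (2 * Kf S i * (phi_bound i)\<^sup>2 + Kf S i + 1)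
           * (real (M0 + M1) * (Kf S n + \<eta> S p n))"
proof -
  let ?Li = "\<beta> S i / (Kf S i + 1)"
  let ?K = "Kf S n" and ?Ki = "Kf S i" and ?h = "\<eta> S p n" and ?hi = "\<eta> S p i"
  let ?M = "real (M0 + M1)"
  have iu: "i \<in> {1..users S}" "i \<noteq> n" using i by auto
  have h: "0 < ?h" "?h \<le> 1" "0 < ?hi" "?hi \<le> 1" using eta_bounds[OF user p] eta_bounds[OF iu(1) p] by auto
  have K: "0 \<le> ?K" "0 \<le> ?Ki" using K_nonneg[OF user] K_nonneg[OF iu(1)] by auto
  have L: "0 \<le> ?Li" using K beta_pos[OF iu(1)] by simp
  have al2: "0 \<le> \<alpha>\<^sup>2" "\<alpha>\<^sup>2 \<le> 1" using al by (auto simp: power_le_one)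
  define F where "F = (\<phi> S n i M0)\<^sup>2 + \<alpha>\<^sup>2 * (\<phi> S n i M1)\<^sup>2"
  define G where "G = real M0 + \<alpha>\<^sup>2 * real M1"
  define H where "H = ?Ki * ?h + ?K * ?hi + ?h * ?hi"
  have eq: "\<Delta>3 S \<alpha> M0 M1 p n i = ?Li * (?K * ?Ki * F + G * H)"
    by (simp add: \<Delta>3_def F_def G_def H_def algebra_simps add_divide_distrib)
  have F: "0 \<le> F" "F \<le> 2 * (phi_bound i)\<^sup>2"
    using al2 phi_sq_le[of i M0] mult_mono[OF al2(2) phi_sq_le[of i M1]] by (auto simp: F_def)
  have G: "0 \<le> G" "G \<le> ?M"
    using al2 mult_right_mono[OF al2(2), of "real M1"] by (auto simp: G_def)
  have H: "0 \<le> H" using h K by (simp add: H_def)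
  show "0 \<le> \<Delta>3 S \<alpha> M0 M1 p n i"
    unfolding eq using L F G H K by (intro mult_nonneg_nonneg add_nonneg_nonneg)
  have "?K * ?Ki * F \<le> (?M * (?K + ?h)) * ?Ki * (2 * (phi_bound i)\<^sup>2)"
  proof (intro mult_mono F)
    have "1 * ?K \<le> ?M * (?K + ?h)" using M h K by (intro mult_mono) auto
    then show "?K \<le> ?M * (?K + ?h)" by simp
  qed (use h K F in auto)
  moreover have "G * H \<le> ?M * ((?K + ?h) * (?Ki + 1))"
  proof (intro mult_mono G H)
    have "?Ki * ?h \<le> ?Ki * (?K + ?h)" using h K by (intro mult_left_mono) auto
    moreover have "(?K + ?h) * ?hi \<le> (?K + ?h) * 1" using h K by (intro mult_left_mono) auto
    ultimately show "H \<le> (?K + ?h) * (?Ki + 1)" by (simp add: H_def algebra_simps)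
  qed auto
  ultimately have "?K * ?Ki * F + G * H \<le> (2 * ?Ki * (phi_bound i)\<^sup>2 + ?Ki + 1) * (?M * (?K + ?h))"
    by (simp add: algebra_simps)
  from mult_left_mono[OF this L] show "\<Delta>3 S \<alpha> M0 M1 p n i \<le> ?Li * (2 * ?Ki * (phi_bound i)\<^sup>2 + ?Ki + 1)
           * (?M * (?K + ?h))"
    unfolding eq by (simp only: mult.assoc)
qed

text \<open>The first bracket is at most 4 (K_n + \<eta>_n)^2, and each summand for another user is
  at most \<beta>_i, both because \<eta> does not exceed 1. The factor K_n + \<eta>_n is again kept
  for the division by the leading denominator.\<close>

lemma Delta4_bounds:
  assumes p: "p > 0"
  shows "0 \<le> \<Delta>4 S p n"
    and "\<Delta>4 S p n \<le> (4 * \<beta> S n + (\<Sum>i\<in>{1..users S} - {n}. \<beta> S i)) * (Kf S n + 1) * (Kf S n + \<eta> S p n)"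
proof -
  let ?K = "Kf S n" and ?h = "\<eta> S p n"
  have h: "0 < ?h" "?h \<le> 1" using eta_bounds[OF user p] by auto
  have K: "0 \<le> ?K" using K_nonneg[OF user] .
  have b: "0 < \<beta> S n" using beta_pos[OF user] .
  define T where "T = (\<Sum>i\<in>{1..users S} - {n}. \<beta> S i * (Kf S i + \<eta> S p i) / (Kf S i + 1))"
  have T: "0 \<le> T" "T \<le> (\<Sum>i\<in>{1..users S} - {n}. \<beta> S i)"
  proof -
    have *: "0 \<le> \<beta> S i * (Kf S i + \<eta> S p i) / (Kf S i + 1) \<and>
        \<beta> S i * (Kf S i + \<eta> S p i) / (Kf S i + 1) \<le> \<beta> S i" if "i \<in> {1..users S} - {n}" for i
      using that beta_pos[of i] K_nonneg[of i] eta_bounds[of i p] p by (simp add: divide_simps)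
    then show "0 \<le> T" unfolding T_def by (intro sum_nonneg) auto
    show "T \<le> (\<Sum>i\<in>{1..users S} - {n}. \<beta> S i)" unfolding T_def using * by (intro sum_mono) auto
  qed
  have eq: "\<Delta>4 S p n = \<beta> S n * (?K\<^sup>2 + 4 * ?K * ?h + 2 * ?h\<^sup>2) + T * ((?K + 1) * (?K + ?h))"
    by (simp add: \<Delta>4_def T_def mult_ac)
  show "0 \<le> \<Delta>4 S p n" unfolding eq using T K h b by simp
  have "?K\<^sup>2 + 4 * ?K * ?h + 2 * ?h\<^sup>2 \<le> 4 * ((?K + ?h) * (?K + ?h))"
    using K h by (simp add: power2_eq_square algebra_simps)
  also have "\<dots> \<le> 4 * ((?K + 1) * (?K + ?h))"
    using K h by (intro mult_left_mono mult_right_mono) auto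
  finally have "\<beta> S n * (?K\<^sup>2 + 4 * ?K * ?h + 2 * ?h\<^sup>2) \<le> \<beta> S n * (4 * ((?K + 1) * (?K + ?h)))"
    using b by (intro mult_left_mono) auto
  moreover have "T * ((?K + 1) * (?K + ?h)) \<le> (\<Sum>i\<in>{1..users S} - {n}. \<beta> S i) * ((?K + 1) * (?K + ?h))"
    using T K h by (intro mult_right_mono) auto
  ultimately show "\<Delta>4 S p n \<le> (4 * \<beta> S n + (\<Sum>i\<in>{1..users S} - {n}. \<beta> S i)) * (?K + 1) * (?K + ?h)"
    unfolding eq by (simp add: algebra_simps)
qed

text \<open>
  Dividing numerator and denominator of the SINR by \<open>g (K\<^sub>n + \<eta>\<^sub>n) (K\<^sub>n + 1)\<close>, where
  \<open>g = M\<^sub>0 + \<alpha> M\<^sub>1\<close>, leaves the main term plus a perturbation of order \<open>p\<close> in both.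
\<close>

lemma R_IP_bounds:
  assumes al: "0 < \<alpha>" "\<alpha> \<le> 1" and rho: "0 \<le> \<rho>"
  shows "\<exists>C\<ge>0. \<forall>M0 M1 p. M0 + M1 > 0 \<longrightarrow> p > 0 \<longrightarrow>
    (let x = (real M0 + \<alpha> * real M1) * p * \<beta> S n * (Kf S n + \<eta> S p n) / (Kf S n + 1)
     in log 2 (1 + x) - log 2 (1 + C * p) \<le> R_IP S \<rho> \<alpha> M0 M1 p n
        \<and> R_IP S \<rho> \<alpha> M0 M1 p n \<le> log 2 (1 + x) + log 2 (1 + C * p))"
proof -
  let ?K = "Kf S n" and ?b = "\<beta> S n"
  have K: "0 \<le> ?K" using K_nonneg[OF user] .
  have b: "0 < ?b" using beta_pos[OF user] .
  define C1 where "C1 = (\<Sum>i=1..users S. \<beta> S i)"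
  define C2 where "C2 = (\<Sum>i\<in>{1..users S} - {n}. \<beta> S i / (Kf S i + 1) * (2 * Kf S i * (phi_bound i)\<^sup>2 + Kf S i + 1))"
  define C3 where "C3 = 4 * ?b + (\<Sum>i\<in>{1..users S} - {n}. \<beta> S i)"
  \<comment> \<open>The four summands bound, per unit of power, the estimation noise, the
    interference, the quantization noise and the excess of the numerator over its main term.\<close>
  define C where "C = C1 + C2 / \<alpha> + \<rho> * C3 + 2 * ?b / \<alpha>"
  have C1: "C1 \<ge> 0" unfolding C1_def using beta_pos by (intro sum_nonneg) (auto intro: less_imp_le)
  have C2: "C2 \<ge> 0" unfolding C2_def using beta_pos K_nonneg
    by (intro sum_nonneg mult_nonneg_nonneg divide_nonneg_nonneg add_nonneg_nonneg) (auto intro: less_imp_le)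
  have C3: "C3 \<ge> 0" unfolding C3_def using b beta_pos
    by (intro add_nonneg_nonneg sum_nonneg) (auto intro: less_imp_le)
  have C0: "C \<ge> 0" unfolding C_def using C1 C2 C3 al rho b by simp
  show ?thesis
  proof (intro exI[of _ C] conjI C0 allI impI)
    fix M0 M1 :: nat and p :: real
    assume M: "M0 + M1 > 0" and p: "p > 0"
    let ?h = "\<eta> S p n"
    have h: "0 < ?h" "?h \<le> 1" using eta_bounds[OF user p] by auto
    define g where "g = real M0 + \<alpha> * real M1"
    define g2 where "g2 = real M0 + \<alpha>\<^sup>2 * real M1"
    \<comment> \<open>Comparability of \<open>g\<close> with the total number of antennas: bounds
      stated in \<open>M0 + M1\<close> turn into bounds in \<open>g\<close> at the price of a factor
      1 / \<alpha>.\<close>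
    have "\<alpha> * real M0 \<le> 1 * real M0" using al by (intro mult_right_mono) auto
    then have g_ge: "\<alpha> * real (M0 + M1) \<le> g" by (simp add: g_def algebra_simps)
    moreover have "0 < \<alpha> * real (M0 + M1)" using al M by (intro mult_pos_pos) auto
    ultimately have g: "0 < g" by linarith
    have M_le: "real (M0 + M1) \<le> g / \<alpha>" using g_ge al by (simp add: field_simps)
    have g2: "0 \<le> g2" "g2 \<le> g"
    proof -
      have "\<alpha>\<^sup>2 \<le> \<alpha>" using al mult_left_mono[of \<alpha> 1 \<alpha>] by (simp add: power2_eq_square)
      then show "0 \<le> g2" "g2 \<le> g" unfolding g_def g2_def by (auto intro: mult_right_mono)
    qed
    define D where "D = g * (?K + ?h) * (?K + 1)"
    have D: "D > 0" unfolding D_def using g K h by simp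
    define x where "x = g * p * ?b * (?K + ?h) / (?K + 1)"
    define e where "e = p * ?b * (g2 * (?h\<^sup>2 + 2 * ?K * ?h)) / D"
    define s where "s = p * (\<Sum>i=1..users S. \<sigma>2 S p i)"
    define t where "t = p * (?K + 1) * (\<Sum>i\<in>{1..users S} - {n}. \<Delta>3 S \<alpha> M0 M1 p n i) / D"
    define r where "r = \<alpha> * \<rho> * p * real M1 * \<Delta>4 S p n / D"
    have x: "x \<ge> 0" unfolding x_def using g p b K h by simp
    have e: "0 \<le> e" "e \<le> 2 * ?b / \<alpha> * p"
    proof -
      show "0 \<le> e" unfolding e_def using p b g2 K h D by simp
      have "?h\<^sup>2 + 2 * ?K * ?h \<le> 2 * ((?K + ?h) * (?K + 1))"
      proof -
        have "?h * (?h + 2 * ?K) \<le> 1 * (2 * (?K + ?h))" using h K by (intro mult_mono) auto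
        also have "\<dots> \<le> 2 * ((?K + ?h) * (?K + 1))" using h K by (simp add: algebra_simps)
        finally show ?thesis by (simp add: power2_eq_square algebra_simps)
      qed
      then have "g2 * (?h\<^sup>2 + 2 * ?K * ?h) \<le> g * (2 * ((?K + ?h) * (?K + 1)))"
        using g2 g h K by (intro mult_mono) auto
      also have "\<dots> = 2 * D" by (simp add: D_def)
      finally have "e \<le> p * ?b * (2 * D) / D"
        unfolding e_def using p b D by (intro divide_right_mono mult_left_mono) auto
      also have "\<dots> = 2 * ?b / 1 * p" using D by simp
      also have "\<dots> \<le> 2 * ?b / \<alpha> * p" using p b al by (intro mult_right_mono divide_left_mono) auto
      finally show "e \<le> 2 * ?b / \<alpha> * p" .
    qed
    have s: "0 \<le> s" "s \<le> C1 * p"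
      unfolding s_def C1_def using sum_sigma2_bounds[OF p] p
      by (simp_all add: mult.commute mult_left_mono)
    have t: "0 \<le> t" "t \<le> C2 / \<alpha> * p"
    proof -
      have "0 \<le> (\<Sum>i\<in>{1..users S} - {n}. \<Delta>3 S \<alpha> M0 M1 p n i)"
        using Delta3_bounds(1)[OF p _ _ al(2) M] al by (intro sum_nonneg) auto
      then show "0 \<le> t" unfolding t_def using p K D by simp
      have "(\<Sum>i\<in>{1..users S} - {n}. \<Delta>3 S \<alpha> M0 M1 p n i) \<le> C2 * (real (M0 + M1) * (?K + ?h))"
        unfolding C2_def sum_distrib_right
        using Delta3_bounds(2)[OF p _ _ al(2) M] al by (intro sum_mono) auto
      also have "\<dots> \<le> C2 * (g / \<alpha> * (?K + ?h))"
        using C2 K h M_le by (intro mult_left_mono mult_right_mono) auto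
      finally have "t \<le> p * (?K + 1) * (C2 * (g / \<alpha> * (?K + ?h))) / D"
        unfolding t_def using p K D by (intro divide_right_mono mult_left_mono) auto
      also have "\<dots> = C2 / \<alpha> * p * (D / D)" unfolding D_def by (simp add: mult_ac)
      finally show "t \<le> C2 / \<alpha> * p" using D by simp
    qed
    have r: "0 \<le> r" "r \<le> \<rho> * C3 * p"
    proof -
      show "0 \<le> r" unfolding r_def using al rho p Delta4_bounds(1)[OF p] D by simp
      have "\<alpha> * \<rho> * p * real M1 * \<Delta>4 S p n = \<rho> * p * (\<alpha> * real M1 * \<Delta>4 S p n)" by simp
      also have "\<dots> \<le> \<rho> * p * (g * (C3 * (?K + 1) * (?K + ?h)))"
        using rho p g al Delta4_bounds[OF p] unfolding C3_def
        by (intro mult_left_mono mult_mono) (auto simp: g_def)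
      also have "\<dots> = \<rho> * C3 * p * D" by (simp add: D_def mult_ac)
      finally have "r \<le> \<rho> * C3 * p * D / D" unfolding r_def using D by (intro divide_right_mono) auto
      then show "r \<le> \<rho> * C3 * p" using D by simp
    qed
    have num: "rate_num S \<alpha> M0 M1 p n = (x + e) * D"
    proof -
      have "x * D = p * ?b * (g\<^sup>2 * (?K + ?h)\<^sup>2)"
        unfolding x_def D_def using K by (simp add: power2_eq_square)
      moreover have "e * D = p * ?b * (g2 * (?h\<^sup>2 + 2 * ?K * ?h))" unfolding e_def using D by simp
      ultimately show ?thesis unfolding rate_num_def g_def g2_def by (simp add: algebra_simps)
    qed
    have den: "rate_den S \<rho> \<alpha> M0 M1 p n = (1 + (s + t + r)) * D"
    proof -
      have "t * D = p * (?K + 1) * (\<Sum>i\<in>{1..users S} - {n}. \<Delta>3 S \<alpha> M0 M1 p n i)"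
        "r * D = \<alpha> * \<rho> * p * real M1 * \<Delta>4 S p n"
        unfolding t_def r_def using D by simp_all
      moreover have "rate_den S \<rho> \<alpha> M0 M1 p n = D * (1 + s)
          + p * (?K + 1) * (\<Sum>i\<in>{1..users S} - {n}. \<Delta>3 S \<alpha> M0 M1 p n i)
          + \<alpha> * \<rho> * p * real M1 * \<Delta>4 S p n"
        by (simp only: rate_den_def D_def s_def g_def)
      ultimately show ?thesis by (simp add: algebra_simps)
    qed
    have R: "R_IP S \<rho> \<alpha> M0 M1 p n = log 2 (1 + (x + e) / (1 + (s + t + r)))"
      unfolding R_IP_def num den using D by simp
    have str: "0 \<le> s + t + r" using s t r by simp
    have "C1 * p \<ge> 0" "C2 / \<alpha> * p \<ge> 0" "\<rho> * C3 * p \<ge> 0" "2 * ?b / \<alpha> * p \<ge> 0"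
      using C1 C2 C3 p al rho b by simp_all
    moreover have "C * p = C1 * p + C2 / \<alpha> * p + \<rho> * C3 * p + 2 * ?b / \<alpha> * p"
      by (simp add: C_def distrib_right)
    ultimately have le: "s + t + r \<le> C * p" "e \<le> C * p"
      using s(2) t(2) r(2) e(2) by linarith+
    have "log 2 (1 + (s + t + r)) \<le> log 2 (1 + C * p)" "log 2 (1 + e) \<le> log 2 (1 + C * p)"
      using le str e(1) by simp_all
    with log_perturbed_ratio_bounds[OF x e(1) str]
    show "let x = (real M0 + \<alpha> * real M1) * p * ?b * (?K + ?h) / (?K + 1)
     in log 2 (1 + x) - log 2 (1 + C * p) \<le> R_IP S \<rho> \<alpha> M0 M1 p n
        \<and> R_IP S \<rho> \<alpha> M0 M1 p n \<le> log 2 (1 + x) + log 2 (1 + C * p)"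
      unfolding Let_def R[symmetric] g_def[symmetric] x_def[symmetric] by linarith
  qed
qed

end

subsection \<open>Power scaling\<close>

context rician_user
begin

text \<open>The fraction in the claimed unquantized limit, with its two powers of the antenna number
  separated. A real argument makes limits at infinity over the reals available.\<close>

definition scaled_gain :: "real \<Rightarrow> real \<Rightarrow> real \<Rightarrow> real" where
  "scaled_gain Eu \<gamma> x = Eu * \<beta> S n
     * (Kf S n * x powr (1 - \<gamma>) + real (pilot_len S) * Eu * \<beta> S n * x powr (1 - 2 * \<gamma>)) / (Kf S n + 1)"

lemma scaled_gain_eq:
  assumes "x > 0"
  shows "Eu * \<beta> S n * (x powr \<gamma> * Kf S n + real (pilot_len S) * Eu * \<beta> S n)
      / (x powr (2 * \<gamma> - 1) * (Kf S n + 1)) = scaled_gain Eu \<gamma> x"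
    and "x * (Eu / x powr \<gamma>) * \<beta> S n * (Kf S n + real (pilot_len S) * (Eu / x powr \<gamma>) * \<beta> S n) / (Kf S n + 1)
      = scaled_gain Eu \<gamma> x"
proof -
  define y where "y = x powr \<gamma>"
  have y: "y > 0" unfolding y_def using assms by simp
  have yy: "x powr (2 * \<gamma>) = y * y" unfolding y_def by (simp flip: powr_add)
  have *: "x powr (1 - \<gamma>) = x / y" "x powr (1 - 2 * \<gamma>) = x / (y * y)" "x powr (2 * \<gamma> - 1) = y * y / x"
    using assms by (simp_all add: powr_diff yy y_def[symmetric])
  have K: "Kf S n + 1 > 0" using K_nonneg[OF user] by simp
  show "Eu * \<beta> S n * (x powr \<gamma> * Kf S n + real (pilot_len S) * Eu * \<beta> S n)
      / (x powr (2 * \<gamma> - 1) * (Kf S n + 1)) = scaled_gain Eu \<gamma> x"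
    unfolding scaled_gain_def * y_def[symmetric] using y assms K by (simp add: field_simps)
  show "x * (Eu / x powr \<gamma>) * \<beta> S n * (Kf S n + real (pilot_len S) * (Eu / x powr \<gamma>) * \<beta> S n) / (Kf S n + 1)
      = scaled_gain Eu \<gamma> x"
    unfolding scaled_gain_def * y_def[symmetric] using y assms K by (simp add: field_simps)
qed

lemma scaled_gain_nonneg: "Eu > 0 \<Longrightarrow> scaled_gain Eu \<gamma> x \<ge> 0"
  unfolding scaled_gain_def using K_nonneg[OF user] beta_pos[OF user]
  by (intro divide_nonneg_nonneg mult_nonneg_nonneg add_nonneg_nonneg) auto

text \<open>All exponents are at most 1, so growth is at most linear; at \<gamma> = 0 and x = 1 both
  powers equal 1 and the value is the sum of the coefficients.\<close>

lemma scaled_gain_le: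
  assumes "x \<ge> 1" "\<gamma> > 0" "Eu > 0"
  shows "scaled_gain Eu \<gamma> x \<le> scaled_gain Eu 0 1 * x"
proof -
  have "x powr (1 - \<gamma>) \<le> x powr 1" "x powr (1 - 2 * \<gamma>) \<le> x powr 1"
    using assms by (intro powr_mono; simp)+
  then have *: "x powr (1 - \<gamma>) \<le> x" "x powr (1 - 2 * \<gamma>) \<le> x" using assms by simp_all
  have "scaled_gain Eu \<gamma> x \<le> Eu * \<beta> S n * (Kf S n * x + real (pilot_len S) * Eu * \<beta> S n * x) / (Kf S n + 1)"
    unfolding scaled_gain_def using K_nonneg[OF user] beta_pos[OF user] assms *
    by (intro divide_right_mono mult_left_mono add_mono) auto
  also have "\<dots> = scaled_gain Eu 0 1 * x"
    by (simp add: scaled_gain_def algebra_simps)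
  finally show ?thesis .
qed

text \<open>Since \<eta>_n = t / (1 + t), one has K_n + \<eta>_n \<le> K_n + t \<le> (K_n +
  \<eta>_n) (1 + t). The error in linearizing \<eta>_n is thus relative, which remains adequate for
  K_n = 0.\<close>

lemma gain_bounds:
  assumes p: "p > 0" and c: "c > 0"
  defines "t \<equiv> real (pilot_len S) * p * \<beta> S n"
  defines "x \<equiv> c * p * \<beta> S n * (Kf S n + \<eta> S p n) / (Kf S n + 1)"
    and "X \<equiv> c * p * \<beta> S n * (Kf S n + t) / (Kf S n + 1)"
  shows "0 \<le> x" "log 2 (1 + x) \<le> log 2 (1 + X)" "log 2 (1 + X) \<le> log 2 (1 + x) + log 2 (1 + t)"
proof -
  let ?K = "Kf S n" and ?h = "\<eta> S p n"
  have K: "0 \<le> ?K" and b: "\<beta> S n > 0" using K_nonneg[OF user] beta_pos[OF user] by auto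
  have t: "t > 0" unfolding t_def using pilots_pos p b by simp
  have h_eq: "?h = t / (1 + t)" by (simp add: \<eta>_def pilot_power_def t_def)
  have h: "0 < ?h" using eta_bounds[OF user p] by simp
  have h1: "?h \<le> t" unfolding h_eq using t by (simp add: field_simps)
  have "?h * (1 + t) = t" unfolding h_eq using t by simp
  moreover have "0 \<le> ?K * t" using K t by simp
  ultimately have h2: "?K + t \<le> (?K + ?h) * (1 + t)" by (simp add: algebra_simps)
  show x: "0 \<le> x" unfolding x_def using c p b K h by simp
  have xX: "x \<le> X" unfolding x_def X_def using c p b K h1
    by (intro divide_right_mono mult_left_mono) auto
  then show "log 2 (1 + x) \<le> log 2 (1 + X)" using x by simp
  have "X \<le> c * p * \<beta> S n * ((?K + ?h) * (1 + t)) / (?K + 1)"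
    unfolding X_def using c p b K h2 by (intro divide_right_mono mult_left_mono) auto
  also have "\<dots> = x * (1 + t)" by (simp add: x_def)
  finally have "1 + X \<le> (1 + x) * (1 + t)" using t by (simp add: algebra_simps)
  then have "log 2 (1 + X) \<le> log 2 ((1 + x) * (1 + t))" using x xX by simp
  also have "\<dots> = log 2 (1 + x) + log 2 (1 + t)" using x t by (simp add: log_mult)
  finally show "log 2 (1 + X) \<le> log 2 (1 + x) + log 2 (1 + t)" .
qed

lemma power_scaling_tendsto_0:
  assumes "filterlim M at_top sequentially" "\<gamma> > 0"
  shows "(\<lambda>s. Eu / real (M s) powr \<gamma>) \<longlonglongrightarrow> 0"
proof -
  have "((\<lambda>x::real. Eu / x powr \<gamma>) \<longlongrightarrow> 0) at_top" using assms(2) by real_asymp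
  then show ?thesis
    by (rule filterlim_compose) (rule filterlim_compose[OF filterlim_real_sequentially assms(1)])
qed

text \<open>The two error terms depend on the power alone. They vanish with it, whether the main
  term tends to zero, to a constant or to infinity.\<close>

lemma R_IP_asymptotics:
  assumes al: "0 < \<alpha>" "\<alpha> \<le> 1" and rho: "0 \<le> \<rho>"
    and Eu: "Eu > 0" and c: "c > 0" and \<gamma>: "\<gamma> > 0"
    and M: "\<And>s. M s = M0 s + M1 s" and M_lim: "filterlim M at_top sequentially"
    and cM: "\<And>s. real (M0 s) + \<alpha> * real (M1 s) = c * real (M s)"
  shows "(\<lambda>s. R_IP S \<rho> \<alpha> (M0 s) (M1 s) (Eu / real (M s) powr \<gamma>) n
            - log 2 (1 + c * scaled_gain Eu \<gamma> (real (M s)))) \<longlonglongrightarrow> 0"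
proof -
  obtain C where C: "C \<ge> 0" and bound: "\<And>M0 M1 p. M0 + M1 > 0 \<Longrightarrow> p > 0 \<Longrightarrow>
      (let x = (real M0 + \<alpha> * real M1) * p * \<beta> S n * (Kf S n + \<eta> S p n) / (Kf S n + 1)
       in log 2 (1 + x) - log 2 (1 + C * p) \<le> R_IP S \<rho> \<alpha> M0 M1 p n
          \<and> R_IP S \<rho> \<alpha> M0 M1 p n \<le> log 2 (1 + x) + log 2 (1 + C * p))"
    using R_IP_bounds[OF al rho] by blast
  define p where "p s = Eu / real (M s) powr \<gamma>" for s
  define t where "t s = real (pilot_len S) * p s * \<beta> S n" for s
  have p0: "p \<longlonglongrightarrow> 0"
    unfolding p_def by (rule power_scaling_tendsto_0[OF M_lim \<gamma>])
  have "eventually (\<lambda>s. M s > 0) sequentially"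
    by (rule eventually_compose_filterlim[OF eventually_gt_at_top M_lim])
  then have "eventually (\<lambda>s. norm (R_IP S \<rho> \<alpha> (M0 s) (M1 s) (p s) n
      - log 2 (1 + c * scaled_gain Eu \<gamma> (real (M s)))) \<le> log 2 (1 + C * p s) + log 2 (1 + t s)) sequentially"
  proof eventually_elim
    case (elim s)
    then have Mpos: "real (M s) > 0" by simp
    have p: "p s > 0" unfolding p_def using Eu Mpos by simp
    have t: "t s \<ge> 0" unfolding t_def using p beta_pos[OF user] by simp
    have cM0: "c * real (M s) > 0" using c Mpos by simp
    have X: "c * real (M s) * p s * \<beta> S n * (Kf S n + t s) / (Kf S n + 1) = c * scaled_gain Eu \<gamma> (real (M s))"
      unfolding t_def p_def scaled_gain_eq(2)[OF Mpos, symmetric] by simp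
    note g = gain_bounds[OF p cM0, folded t_def, unfolded X]
    have "M0 s + M1 s > 0" using elim by (simp add: M)
    note r = bound[OF this p, unfolded Let_def cM]
    have "C * p s \<ge> 0" using C p by simp
    then have "log 2 (1 + C * p s) \<ge> 0" by (subst zero_le_log_cancel_iff) linarith+
    moreover have "log 2 (1 + t s) \<ge> 0" using t by simp
    ultimately show ?case using r g by (simp add: abs_le_iff)
  qed
  moreover have "(\<lambda>s. log 2 (1 + C * p s) + log 2 (1 + t s)) \<longlonglongrightarrow> 0"
    unfolding t_def using p0 by (auto intro!: tendsto_eq_intros)
  ultimately show ?thesis
    unfolding p_def[symmetric] by (rule Lim_null_comparison)
qed

lemma powr_neg_mult_log_tendsto_0:
  assumes "a > 0" "C > 0"
  shows "((\<lambda>x::real. x powr (- a) * log 2 (1 + C * x)) \<longlongrightarrow> 0) at_top"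
  using assms unfolding log_def by real_asymp

lemma exact_rate_asymptotics:
  assumes Eu: "Eu > 0" and \<gamma>: "\<gamma> > 0" and M_lim: "filterlim M at_top sequentially"
  shows "(\<lambda>s. exact_unquantized_rate S (M s) (Eu / real (M s) powr \<gamma>) n
            - log 2 (1 + scaled_gain Eu \<gamma> (real (M s)))) \<longlonglongrightarrow> 0"
proof -
  define p where "p s = Eu / real (M s) powr \<gamma>" for s
  define t where "t s = real (pilot_len S) * p s * \<beta> S n" for s
  define q where "q s = p s * (\<Sum>i=1..users S. \<sigma>2 S (p s) i)" for s
  define V where "V = 2 + 2 * gaussian_sq_variance"
  define C where "C = (\<Sum>i\<in>{1..users S} - {n}. interference_const i)"
  define C4 where "C4 = scaled_gain Eu 0 1"
  \<comment> \<open>With \<epsilon> = M^(-\<delta>), the two parts of the exceptional probability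
    are of order M^(-(1 - 2\<delta>)) and M^(-(\<gamma> - \<delta>)); this \<delta> makes both decay
    like a power.\<close>
  define \<delta> where "\<delta> = min \<gamma> 1 / 4"
  have \<delta>: "0 < \<delta>" "2 * \<delta> < 1" "\<delta> < \<gamma>" using \<gamma> by (auto simp: \<delta>_def min_def)
  define \<epsilon> where "\<epsilon> s = real (M s) powr (- \<delta>)" for s
  define a where "a s = (1 - \<epsilon> s) / (\<epsilon> s / (1 - \<epsilon> s) + 1 + q s)" for s
  define b where "b s = V / real (M s) / (\<epsilon> s)\<^sup>2 + p s * C / \<epsilon> s" for s
  have V: "V > 0" unfolding V_def using gaussian_sq_variance_nonneg by simp
  have C: "C \<ge> 0" unfolding C_def interference_const_def
    using beta_pos K_nonneg
    by (intro sum_nonneg mult_nonneg_nonneg add_nonneg_nonneg divide_nonneg_nonneg) (auto intro: less_imp_le)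
  have C4: "C4 > 0" unfolding C4_def scaled_gain_def using Eu beta_pos[OF user] K_nonneg[OF user] pilots_pos
    by (intro divide_pos_pos mult_pos_pos add_nonneg_pos) auto
  have M_real: "filterlim (\<lambda>s. real (M s)) at_top sequentially"
    by (rule filterlim_compose[OF filterlim_real_sequentially M_lim])
  have p0: "p \<longlonglongrightarrow> 0"
    unfolding p_def by (rule power_scaling_tendsto_0[OF M_lim \<gamma>])
  have \<epsilon>0: "\<epsilon> \<longlonglongrightarrow> 0"
    unfolding \<epsilon>_def using tendsto_neg_powr[OF _ M_real, of "- \<delta>"] \<delta> by simp
  \<comment> \<open>One antenna would give \<epsilon> = 1, outside the range of the lower
    bound.\<close>
  have ev: "eventually (\<lambda>s. M s > 1) sequentially"
    by (rule eventually_compose_filterlim[OF eventually_gt_at_top M_lim])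
  have q0: "q \<longlonglongrightarrow> 0"
  proof (rule tendsto_sandwich)
    show "eventually (\<lambda>s. 0 \<le> q s) sequentially" "eventually (\<lambda>s. q s \<le> p s * (\<Sum>i=1..users S. \<beta> S i)) sequentially"
      using ev by (eventually_elim, use sum_sigma2_bounds Eu in \<open>simp add: q_def p_def mult_left_mono divide_right_mono\<close>)+
    show "(\<lambda>s. p s * (\<Sum>i=1..users S. \<beta> S i)) \<longlonglongrightarrow> 0" using p0 by (auto intro!: tendsto_eq_intros)
  qed simp
  have a1: "a \<longlonglongrightarrow> 1" unfolding a_def using q0 \<epsilon>0 by (auto intro!: tendsto_eq_intros)
  \<comment> \<open>The loss on the exceptional event is its probability bound times a logarithm of
    at most linear growth; power decay wins.\<close>
  have blog: "(\<lambda>s. b s * log 2 (1 + C4 * real (M s))) \<longlonglongrightarrow> 0"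
  proof -
    have "((\<lambda>x. V * (x powr (- (1 - 2 * \<delta>)) * log 2 (1 + C4 * x))
        + Eu * C * (x powr (- (\<gamma> - \<delta>)) * log 2 (1 + C4 * x))) \<longlongrightarrow> V * 0 + Eu * C * 0) at_top"
      using \<delta> C4 by (intro tendsto_intros powr_neg_mult_log_tendsto_0) auto
    from filterlim_compose[OF this M_real]
    have "(\<lambda>s. V * (real (M s) powr (- (1 - 2 * \<delta>)) * log 2 (1 + C4 * real (M s)))
        + Eu * C * (real (M s) powr (- (\<gamma> - \<delta>)) * log 2 (1 + C4 * real (M s)))) \<longlonglongrightarrow> 0" by simp
    moreover have "eventually (\<lambda>s. V * (real (M s) powr (- (1 - 2 * \<delta>)) * log 2 (1 + C4 * real (M s)))
        + Eu * C * (real (M s) powr (- (\<gamma> - \<delta>)) * log 2 (1 + C4 * real (M s)))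
        = b s * log 2 (1 + C4 * real (M s))) sequentially"
      using ev
    proof eventually_elim
      case (elim s)
      then have x: "real (M s) > 0" by simp
      have 1: "V / real (M s) / (\<epsilon> s)\<^sup>2 = V * real (M s) powr (- (1 - 2 * \<delta>))"
        using x unfolding \<epsilon>_def by (simp add: powr_diff powr_minus powr_power divide_simps mult.commute)
      have 2: "p s * C / \<epsilon> s = Eu * C * real (M s) powr (- (\<gamma> - \<delta>))"
        using x unfolding \<epsilon>_def p_def by (simp add: powr_diff powr_minus divide_simps)
      show ?case unfolding b_def 1 2 by (simp add: algebra_simps)
    qed
    ultimately show ?thesis by (rule Lim_transform_eventually)
  qed
  show ?thesis unfolding p_def[symmetric]
  proof (rule tendsto_sandwich)
    show "eventually (\<lambda>s. log 2 (a s) - log 2 (1 + t s) - b s * log 2 (1 + C4 * real (M s))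
        \<le> exact_unquantized_rate S (M s) (p s) n - log 2 (1 + scaled_gain Eu \<gamma> (real (M s)))) sequentially"
      using ev
    proof eventually_elim
      case (elim s)
      then have x: "real (M s) > 0" and Ms: "M s > 0" by simp_all
      have p: "p s > 0" unfolding p_def using Eu x by simp
      have q: "q s \<ge> 0" unfolding q_def using p sum_sigma2_bounds(1)[OF p] by simp
      have \<epsilon>: "0 < \<epsilon> s" "\<epsilon> s < 1"
        unfolding \<epsilon>_def using x elim \<delta> by (auto simp: powr_minus intro!: inverse_less_1_iff[THEN iffD2])
      have den: "\<epsilon> s / (1 - \<epsilon> s) + 1 + q s \<ge> 1" using \<epsilon> q by simp
      have a: "0 < a s" "a s \<le> 1"
      proof -
        show "0 < a s" unfolding a_def using \<epsilon> den by (intro divide_pos_pos) auto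
        have "a s \<le> 1 / 1" unfolding a_def using \<epsilon> den by (intro frac_le) auto
        then show "a s \<le> 1" by simp
      qed
      have X: "real (M s) * p s * \<beta> S n * (Kf S n + t s) / (Kf S n + 1) = scaled_gain Eu \<gamma> (real (M s))"
        unfolding t_def p_def scaled_gain_eq(2)[OF x, symmetric] by simp
      have mu: "real (M s) * p s * \<beta> S n * (Kf S n + \<eta> S (p s) n) / (Kf S n + 1) = p s * mean_gain (M s) (p s)"
        by (simp add: mean_gain_def)
      define \<mu> where "\<mu> = p s * mean_gain (M s) (p s)"
      note g = gain_bounds[OF p x, folded t_def, unfolded X mu, folded \<mu>_def]
      \<comment> \<open>As \<open>a s\<close> is at most 1, moving it out of the SINR costs only log
        2 (\<open>a s\<close>), which tends to 0.\<close>
      have aL: "log 2 (a s) + log 2 (1 + \<mu>) \<le> log 2 (1 + a s * \<mu>)"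
      proof -
        have "a s * (1 + \<mu>) \<le> 1 + a s * \<mu>" using a by (simp add: algebra_simps)
        moreover have "0 < a s * (1 + \<mu>)" using a g(1) by (intro mult_pos_pos) auto
        ultimately have "log 2 (a s * (1 + \<mu>)) \<le> log 2 (1 + a s * \<mu>)" by simp
        then show ?thesis using a g(1) by (simp add: log_mult)
      qed
      have "scaled_gain Eu \<gamma> (real (M s)) \<le> C4 * real (M s)"
        unfolding C4_def using elim \<gamma> Eu by (intro scaled_gain_le) auto
      then have "log 2 (1 + scaled_gain Eu \<gamma> (real (M s))) \<le> log 2 (1 + C4 * real (M s))"
        using scaled_gain_nonneg[OF Eu, of \<gamma> "real (M s)"] by simp
      moreover have "log 2 (1 + a s * \<mu>) \<le> log 2 (1 + \<mu>)"
      proof -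
        have "a s * \<mu> \<le> \<mu>" "0 \<le> a s * \<mu>" using a g(1) by (auto intro: mult_left_le_one_le)
        then show ?thesis by simp
      qed
      ultimately have "log 2 (1 + a s * \<mu>) \<le> log 2 (1 + C4 * real (M s))" using g by linarith
      moreover have "b s \<ge> 0" unfolding b_def using V C p \<epsilon> by simp
      ultimately have bL: "b s * log 2 (1 + a s * \<mu>) \<le> b s * log 2 (1 + C4 * real (M s))"
        by (rule mult_left_mono)
      have "(1 - b s) * log 2 (1 + a s * \<mu>) \<le> exact_unquantized_rate S (M s) (p s) n"
        using exact_rate_bounds(2)[OF p Ms \<epsilon>]
        unfolding b_def V_def C_def a_def \<mu>_def q_def by (simp only: diff_diff_eq)
      then have "log 2 (1 + a s * \<mu>) - b s * log 2 (1 + a s * \<mu>) \<le> exact_unquantized_rate S (M s) (p s) n"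
        by (simp add: algebra_simps)
      with aL bL g(3) show ?case by linarith
    qed
    show "eventually (\<lambda>s. exact_unquantized_rate S (M s) (p s) n
        - log 2 (1 + scaled_gain Eu \<gamma> (real (M s))) \<le> 0) sequentially"
      using ev
    proof eventually_elim
      case (elim s)
      then have x: "real (M s) > 0" and Ms: "M s > 0" by simp_all
      have p: "p s > 0" unfolding p_def using Eu x by simp
      have X: "real (M s) * p s * \<beta> S n * (Kf S n + t s) / (Kf S n + 1) = scaled_gain Eu \<gamma> (real (M s))"
        unfolding t_def p_def scaled_gain_eq(2)[OF x, symmetric] by simp
      have mu: "real (M s) * p s * \<beta> S n * (Kf S n + \<eta> S (p s) n) / (Kf S n + 1) = p s * mean_gain (M s) (p s)"
        by (simp add: mean_gain_def)
      note g = gain_bounds[OF p x, folded t_def, unfolded X mu]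
      show ?case using exact_rate_bounds(1)[OF p Ms] g(2) by linarith
    qed
    have "(\<lambda>s. log 2 (a s) - log 2 (1 + t s) - b s * log 2 (1 + C4 * real (M s)))
        \<longlonglongrightarrow> log 2 1 - log 2 (1 + real (pilot_len S) * 0 * \<beta> S n) - 0"
      unfolding t_def by (intro tendsto_intros a1 p0 blog) auto
    then show "(\<lambda>s. log 2 (a s) - log 2 (1 + t s) - b s * log 2 (1 + C4 * real (M s))) \<longlonglongrightarrow> 0"
      by simp
  qed simp
qed

end

section \<open>From vanishing differences to limits, and the critical exponents\<close>

lemma tendsto_log_transfer:
  fixes r y :: "nat \<Rightarrow> real"
  assumes "(\<lambda>s. r s - log 2 (1 + y s)) \<longlonglongrightarrow> 0" "y \<longlonglongrightarrow> L" "L \<ge> 0"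
  shows "r \<longlonglongrightarrow> log 2 (1 + L)"
proof -
  have "(\<lambda>s. (r s - log 2 (1 + y s)) + log 2 (1 + y s)) \<longlonglongrightarrow> 0 + log 2 (1 + L)"
    using assms by (intro tendsto_intros) auto
  then show ?thesis by simp
qed

lemma filterlim_log_transfer:
  fixes r y :: "nat \<Rightarrow> real"
  assumes "(\<lambda>s. r s - log 2 (1 + y s)) \<longlonglongrightarrow> 0" "filterlim y at_top sequentially"
  shows "filterlim r at_top sequentially"
proof -
  have "filterlim (\<lambda>y::real. log 2 (1 + y)) at_top at_top" unfolding log_def by real_asymp
  from filterlim_compose[OF this assms(2)] have "filterlim (\<lambda>s. log 2 (1 + y s)) at_top sequentially" .
  from filterlim_tendsto_add_at_top[OF assms(1) this] show ?thesis by simp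
qed

context rician_user
begin

text \<open>Without a line of sight only the power 1 - 2\<gamma> survives, so 1/2 is
  critical.\<close>

lemma scaled_gain_rayleigh:
  assumes "Kf S n = 0" "Eu > 0"
  shows "(scaled_gain Eu (1/2) \<longlongrightarrow> real (pilot_len S) * Eu\<^sup>2 * (\<beta> S n)\<^sup>2) at_top"
    and "\<gamma> > 1/2 \<Longrightarrow> (scaled_gain Eu \<gamma> \<longlongrightarrow> 0) at_top"
    and "\<gamma> < 1/2 \<Longrightarrow> filterlim (scaled_gain Eu \<gamma>) at_top at_top"
proof -
  define A where "A = real (pilot_len S) * Eu\<^sup>2 * (\<beta> S n)\<^sup>2"
  have A: "A > 0" unfolding A_def using assms pilots_pos beta_pos[OF user] by simp
  have eq: "scaled_gain Eu \<gamma> = (\<lambda>x. A * x powr (1 - 2 * \<gamma>))" for \<gamma>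
    using assms by (auto simp: scaled_gain_def A_def power2_eq_square)
  show "(scaled_gain Eu (1/2) \<longlongrightarrow> real (pilot_len S) * Eu\<^sup>2 * (\<beta> S n)\<^sup>2) at_top"
    unfolding eq A_def[symmetric] by real_asymp
  show "(scaled_gain Eu \<gamma> \<longlongrightarrow> 0) at_top" if "\<gamma> > 1/2"
    unfolding eq using that A by real_asymp
  show "filterlim (scaled_gain Eu \<gamma>) at_top at_top" if "\<gamma> < 1/2"
    unfolding eq using that A by real_asymp
qed

text \<open>The line-of-sight power 1 - \<gamma> dominates 1 - 2\<gamma>, moving the critical
  exponent to 1.\<close>

lemma scaled_gain_rician:
  assumes "Kf S n > 0" "Eu > 0"
  shows "(scaled_gain Eu 1 \<longlongrightarrow> Eu * \<beta> S n * Kf S n / (Kf S n + 1)) at_top"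
    and "\<gamma> > 1 \<Longrightarrow> (scaled_gain Eu \<gamma> \<longlongrightarrow> 0) at_top"
    and "\<gamma> < 1 \<Longrightarrow> filterlim (scaled_gain Eu \<gamma>) at_top at_top"
proof -
  define A where "A = Eu * \<beta> S n * Kf S n / (Kf S n + 1)"
  define B where "B = Eu * \<beta> S n * (real (pilot_len S) * Eu * \<beta> S n) / (Kf S n + 1)"
  have A: "A > 0" and B: "B > 0" unfolding A_def B_def using assms pilots_pos beta_pos[OF user] by simp_all
  have eq: "scaled_gain Eu \<gamma> = (\<lambda>x. A * x powr (1 - \<gamma>) + B * x powr (1 - 2 * \<gamma>))" for \<gamma>
    by (auto simp: scaled_gain_def A_def B_def add_divide_distrib algebra_simps)
  show "(scaled_gain Eu 1 \<longlongrightarrow> Eu * \<beta> S n * Kf S n / (Kf S n + 1)) at_top"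
    unfolding eq A_def[symmetric] by real_asymp
  show "(scaled_gain Eu \<gamma> \<longlongrightarrow> 0) at_top" if \<gamma>: "\<gamma> > 1"
  proof -
    have "((\<lambda>x::real. x powr (1 - \<gamma>)) \<longlongrightarrow> 0) at_top" "((\<lambda>x::real. x powr (1 - 2 * \<gamma>)) \<longlongrightarrow> 0) at_top"
      using \<gamma> by real_asymp+
    from tendsto_add[OF tendsto_mult_left[OF this(1), of A] tendsto_mult_left[OF this(2), of B]]
    show ?thesis unfolding eq by simp
  qed
  show "filterlim (scaled_gain Eu \<gamma>) at_top at_top" if "\<gamma> < 1"
  \<comment> \<open>The exponent 1 - 2\<gamma> may have either sign here; that term is simply
    dropped as nonnegative.\<close>
  proof (rule filterlim_at_top_mono)
    show "filterlim (\<lambda>x. A * x powr (1 - \<gamma>)) at_top at_top"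
      using that A by real_asymp
    show "eventually (\<lambda>x. A * x powr (1 - \<gamma>) \<le> scaled_gain Eu \<gamma> x) at_top"
      unfolding eq using B by (intro always_eventually) simp
  qed
qed

end

text \<open>The claimed limit still contains \<open>M\<close>, so convergence means that the
  difference tends to 0. The scaling law becomes a trichotomy: a positive finite limit at the
  critical exponent, vanishing above it, divergence below it. The auxiliary index \<open>s\<close>
  lets \<open>M\<close> run through numbers for which \<kappa> \<open>M\<close> is an
  integer.\<close>

theorem mainTheorem3:
  fixes S :: rician_uplink
    and n :: nat
    and \<rho> \<alpha> \<kappa> Eu :: real
    and M0 M1 M :: "nat \<Rightarrow> nat"
    and pu R :: "real \<Rightarrow> nat \<Rightarrow> real"
  assumes n: "n \<in> {1..users S}"
    and beta: "\<And>i. i \<in> {1..users S} \<Longrightarrow> \<beta> S i > 0"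
    and K: "\<And>i. i \<in> {1..users S} \<Longrightarrow> Kf S i \<ge> 0"
    and spacing: "spacing S > 0" and wavelength: "wavelength S > 0"
    and pilots: "pilot_len S > 0"
    and phi_defined: "\<And>i. i \<in> {1..users S} - {n} \<Longrightarrow>
          sin (kd S * (sin (\<theta> S n) - sin (\<theta> S i)) / 2) \<noteq> 0"
    and rho: "0 \<le> \<rho>" "\<rho> < 1" and alpha: "\<alpha> = 1 - \<rho>"
    and kappa: "0 \<le> \<kappa>" "\<kappa> \<le> 1"
    and Eu: "Eu > 0"
    and M: "\<And>s. M s = M0 s + M1 s"
    and M0: "\<And>s. real (M0 s) = \<kappa> * real (M s)"
    and M_infinity: "filterlim M at_top sequentially"
    and pu: "\<And>\<gamma> s. pu \<gamma> s = Eu / real (M s) powr \<gamma>"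
    and R: "\<And>\<gamma> s. R \<gamma> s = R_IP S \<rho> \<alpha> (M0 s) (M1 s) (pu \<gamma> s) n"
  shows
    "(\<forall>\<gamma>>0. (\<lambda>s. R \<gamma> s
        - log 2 (1 + (\<rho> * \<kappa> + \<alpha>)
            * (Eu * \<beta> S n * (real (M s) powr \<gamma> * Kf S n + real (pilot_len S) * Eu * \<beta> S n)
               / (real (M s) powr (2 * \<gamma> - 1) * (Kf S n + 1))))) \<longlonglongrightarrow> 0)
   \<and> (Kf S n = 0 \<longrightarrow>
        (R (1/2) \<longlonglongrightarrow> log 2 (1 + (\<rho> * \<kappa> + \<alpha>) * (real (pilot_len S) * Eu\<^sup>2 * (\<beta> S n)\<^sup>2)))
        \<and> 0 < log 2 (1 + (\<rho> * \<kappa> + \<alpha>) * (real (pilot_len S) * Eu\<^sup>2 * (\<beta> S n)\<^sup>2))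
        \<and> (\<forall>\<gamma>>1/2. R \<gamma> \<longlonglongrightarrow> 0)
        \<and> (\<forall>\<gamma>. 0 < \<gamma> \<and> \<gamma> < 1/2 \<longrightarrow> filterlim (R \<gamma>) at_top sequentially))
   \<and> (Kf S n > 0 \<longrightarrow>
        (R 1 \<longlonglongrightarrow> log 2 (1 + (\<rho> * \<kappa> + \<alpha>) * (Eu * \<beta> S n * Kf S n / (Kf S n + 1))))
        \<and> 0 < log 2 (1 + (\<rho> * \<kappa> + \<alpha>) * (Eu * \<beta> S n * Kf S n / (Kf S n + 1)))
        \<and> (\<forall>\<gamma>>1. R \<gamma> \<longlonglongrightarrow> 0)
        \<and> (\<forall>\<gamma>. 0 < \<gamma> \<and> \<gamma> < 1 \<longrightarrow> filterlim (R \<gamma>) at_top sequentially))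
   \<and> (\<kappa> = 0 \<longrightarrow>
        (\<forall>\<gamma>>0. (\<lambda>s. R \<gamma> s
          - log 2 (1 + \<alpha> * Eu * \<beta> S n
                * (real (M s) powr \<gamma> * Kf S n + real (pilot_len S) * Eu * \<beta> S n)
                / (real (M s) powr (2 * \<gamma> - 1) * (Kf S n + 1)))) \<longlonglongrightarrow> 0))
   \<and> (\<kappa> = 1 \<and> \<alpha> = 1 \<longrightarrow>
        (\<forall>\<gamma>>0.
          ((\<lambda>s. R \<gamma> s
             - log 2 (1 + Eu * \<beta> S n
                   * (real (M s) powr \<gamma> * Kf S n + real (pilot_len S) * Eu * \<beta> S n)
                   / (real (M s) powr (2 * \<gamma> - 1) * (Kf S n + 1)))) \<longlonglongrightarrow> 0)
          \<and> ((\<lambda>s. exact_unquantized_rate S (M s) (pu \<gamma> s) n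
             - log 2 (1 + Eu * \<beta> S n
                   * (real (M s) powr \<gamma> * Kf S n + real (pilot_len S) * Eu * \<beta> S n)
                   / (real (M s) powr (2 * \<gamma> - 1) * (Kf S n + 1)))) \<longlonglongrightarrow> 0))
        \<and> (Kf S n = 0 \<longrightarrow>
             R (1/2) \<longlonglongrightarrow> log 2 (1 + real (pilot_len S) * Eu\<^sup>2 * (\<beta> S n)\<^sup>2))
        \<and> (Kf S n > 0 \<longrightarrow>
             R 1 \<longlonglongrightarrow> log 2 (1 + Eu * \<beta> S n * Kf S n / (Kf S n + 1))))"
proof -
  interpret rician_user S n
    using n beta K pilots phi_defined by unfold_locales auto
  define c where "c = \<rho> * \<kappa> + \<alpha>"
  have al: "0 < \<alpha>" "\<alpha> \<le> 1" using rho alpha by auto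
  have c: "c > 0" unfolding c_def using rho kappa al by (intro add_nonneg_pos mult_nonneg_nonneg) auto
  \<comment> \<open>With shares \<kappa> and 1 - \<kappa>, the effective gain per antenna is
    \<kappa> + \<alpha> (1 - \<kappa>) = \<rho> \<kappa> + \<alpha>.\<close>
  have cM: "real (M0 s) + \<alpha> * real (M1 s) = c * real (M s)" for s
  proof -
    have M1: "real (M1 s) = real (M s) - \<kappa> * real (M s)" using M[of s] M0[of s] by simp
    show ?thesis unfolding c_def M0 alpha M1 by (simp add: algebra_simps)
  qed
  have M_real: "filterlim (\<lambda>s. real (M s)) at_top sequentially"
    by (rule filterlim_compose[OF filterlim_real_sequentially M_infinity])
  have ev: "eventually (\<lambda>s. real (M s) > 0) sequentially"
    by (rule eventually_compose_filterlim[OF eventually_gt_at_top M_real])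
  have asym: "(\<lambda>s. R \<gamma> s - log 2 (1 + c * scaled_gain Eu \<gamma> (real (M s)))) \<longlonglongrightarrow> 0" if "\<gamma> > 0" for \<gamma>
    unfolding R pu by (rule R_IP_asymptotics[OF al rho(1) Eu c that M M_infinity cM])
  \<comment> \<open>The displayed fractions agree with \<open>scaled_gain\<close> for positive
    \<open>M\<close> only, hence just eventually, which is enough for a limit.\<close>
  have to_scaled_gain: "(\<lambda>s. r s - log 2 (1 + f s)) \<longlonglongrightarrow> 0"
    if lim: "(\<lambda>s. r s - log 2 (1 + d * scaled_gain Eu \<gamma> (real (M s)))) \<longlonglongrightarrow> 0"
      and eq: "\<And>s. f s = d * (Eu * \<beta> S n * (real (M s) powr \<gamma> * Kf S n + real (pilot_len S) * Eu * \<beta> S n)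
        / (real (M s) powr (2 * \<gamma> - 1) * (Kf S n + 1)))"
    for r f :: "nat \<Rightarrow> real" and \<gamma> d
    using lim by (rule Lim_transform_eventually) (use ev in \<open>eventually_elim, simp only: eq scaled_gain_eq(1)\<close>)
  have lim: "R \<gamma> \<longlonglongrightarrow> log 2 (1 + c * L)"
    if "\<gamma> > 0" "(scaled_gain Eu \<gamma> \<longlongrightarrow> L) at_top" "L \<ge> 0" for \<gamma> L
    using that c by (intro tendsto_log_transfer[OF asym] tendsto_mult_left
        filterlim_compose[OF _ M_real] mult_nonneg_nonneg) auto
  have lim0: "R \<gamma> \<longlonglongrightarrow> 0" if "\<gamma> > 0" "(scaled_gain Eu \<gamma> \<longlongrightarrow> 0) at_top" for \<gamma>
    using lim[OF that] by simp
  have lim_top: "filterlim (R \<gamma>) at_top sequentially"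
    if "\<gamma> > 0" "filterlim (scaled_gain Eu \<gamma>) at_top at_top" for \<gamma>
    using that c by (intro filterlim_log_transfer[OF asym]
        filterlim_tendsto_pos_mult_at_top[OF tendsto_const] filterlim_compose[OF _ M_real]) auto
  have b: "\<beta> S n > 0" by (rule beta[OF n])
  have rayleigh: "R (1/2) \<longlonglongrightarrow> log 2 (1 + c * (real (pilot_len S) * Eu\<^sup>2 * (\<beta> S n)\<^sup>2))"
    if "Kf S n = 0"
    by (rule lim) (use scaled_gain_rayleigh[OF that Eu] in auto)
  have rician: "R 1 \<longlonglongrightarrow> log 2 (1 + c * (Eu * \<beta> S n * Kf S n / (Kf S n + 1)))"
    if "Kf S n > 0"
    by (rule lim) (use scaled_gain_rician[OF that Eu] b Eu that in auto)
  have pos: "0 < log 2 (1 + c * y)" if "y > 0" for y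
    using mult_pos_pos[OF c that] by simp
  have c1: "c = 1" if "\<kappa> = 1 \<and> \<alpha> = 1" using that alpha by (simp add: c_def)
  have exact: "(\<lambda>s. exact_unquantized_rate S (M s) (pu \<gamma> s) n
      - log 2 (1 + 1 * scaled_gain Eu \<gamma> (real (M s)))) \<longlonglongrightarrow> 0" if "\<gamma> > 0" for \<gamma>
    unfolding pu mult_1 by (rule exact_rate_asymptotics[OF Eu that M_infinity])
  show ?thesis
    unfolding c_def[symmetric]
  proof (intro conjI impI allI; (elim conjE)?)
    show "(\<lambda>s. R \<gamma> s - log 2 (1 + c
            * (Eu * \<beta> S n * (real (M s) powr \<gamma> * Kf S n + real (pilot_len S) * Eu * \<beta> S n)
               / (real (M s) powr (2 * \<gamma> - 1) * (Kf S n + 1))))) \<longlonglongrightarrow> 0" if "0 < \<gamma>" for \<gamma>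
      using asym[OF that] by (rule to_scaled_gain) simp
  next
    assume K0: "Kf S n = 0"
    show "R (1/2) \<longlonglongrightarrow> log 2 (1 + c * (real (pilot_len S) * Eu\<^sup>2 * (\<beta> S n)\<^sup>2))"
      by (rule rayleigh[OF K0])
    show "0 < log 2 (1 + c * (real (pilot_len S) * Eu\<^sup>2 * (\<beta> S n)\<^sup>2))"
      using pilots Eu b by (intro pos) simp
    show "R \<gamma> \<longlonglongrightarrow> 0" if "1/2 < \<gamma>" for \<gamma>
      using that scaled_gain_rayleigh(2)[OF K0 Eu that] by (intro lim0) auto
    show "filterlim (R \<gamma>) at_top sequentially" if "0 < \<gamma>" "\<gamma> < 1/2" for \<gamma>
      using that scaled_gain_rayleigh(3)[OF K0 Eu that(2)] by (intro lim_top) auto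
  next
    assume K1: "0 < Kf S n"
    show "R 1 \<longlonglongrightarrow> log 2 (1 + c * (Eu * \<beta> S n * Kf S n / (Kf S n + 1)))"
      by (rule rician[OF K1])
    show "0 < log 2 (1 + c * (Eu * \<beta> S n * Kf S n / (Kf S n + 1)))"
      using Eu b K1 by (intro pos) simp
    show "R \<gamma> \<longlonglongrightarrow> 0" if "1 < \<gamma>" for \<gamma>
      using that scaled_gain_rician(2)[OF K1 Eu that] by (intro lim0) auto
    show "filterlim (R \<gamma>) at_top sequentially" if "0 < \<gamma>" "\<gamma> < 1" for \<gamma>
      using that scaled_gain_rician(3)[OF K1 Eu that(2)] by (intro lim_top) auto
  next
    assume k: "\<kappa> = 0"
    show "(\<lambda>s. R \<gamma> s - log 2 (1 + \<alpha> * Eu * \<beta> S n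
                * (real (M s) powr \<gamma> * Kf S n + real (pilot_len S) * Eu * \<beta> S n)
                / (real (M s) powr (2 * \<gamma> - 1) * (Kf S n + 1)))) \<longlonglongrightarrow> 0" if "0 < \<gamma>" for \<gamma>
      using asym[OF that] by (rule to_scaled_gain) (simp add: c_def k mult.assoc)
  next
    assume "\<kappa> = 1" "\<alpha> = 1"
    then have c': "c = 1" using c1 by simp
    show "(\<lambda>s. R \<gamma> s - log 2 (1 + Eu * \<beta> S n
                   * (real (M s) powr \<gamma> * Kf S n + real (pilot_len S) * Eu * \<beta> S n)
                   / (real (M s) powr (2 * \<gamma> - 1) * (Kf S n + 1)))) \<longlonglongrightarrow> 0" if "0 < \<gamma>" for \<gamma>
      using asym[OF that] by (rule to_scaled_gain) (simp add: c')
    show "(\<lambda>s. exact_unquantized_rate S (M s) (pu \<gamma> s) n - log 2 (1 + Eu * \<beta> S n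
                   * (real (M s) powr \<gamma> * Kf S n + real (pilot_len S) * Eu * \<beta> S n)
                   / (real (M s) powr (2 * \<gamma> - 1) * (Kf S n + 1)))) \<longlonglongrightarrow> 0" if "0 < \<gamma>" for \<gamma>
      using exact[OF that] by (rule to_scaled_gain) simp
    show "R (1/2) \<longlonglongrightarrow> log 2 (1 + real (pilot_len S) * Eu\<^sup>2 * (\<beta> S n)\<^sup>2)" if "Kf S n = 0"
      using rayleigh[OF that] by (simp add: c')
    show "R 1 \<longlonglongrightarrow> log 2 (1 + Eu * \<beta> S n * Kf S n / (Kf S n + 1))" if "Kf S n > 0"
      using rician[OF that] by (simp add: c')
  qed
qed

end
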